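(* Let $q$ be a prime power, and let $n$ range over the odd positive integers. Let $Z^{\mathrm{odd}}_t$ and $Y_t^{(n)}$ be the processes defined in the context. Let $0<t_1<t_2<\cdots<t_k$ be a deterministic sequence of times. Assume that $Z^{\mathrm{odd}}_0$ is a (deterministic) constant in $\mathbb{Z}+\frac12$, and that $Y_0^{(n)}=Z^{\mathrm{odd}}_0$ for all large enough $n$. Then $\left(Y_{t_1}^{(n)},Y_{t_2}^{(n)},\dots,Y_{t_k}^{(n)}\right)$ converges to $\left(Z^{\mathrm{odd}}_{t_1},Z^{\mathrm{odd}}_{t_2},\dots,Z^{\mathrm{odd}}_{t_k}\right)$ in total variation distance as $n\to\infty$.
   Context: $(a;q)_r=\prod_{i=0}^{r-1}(1-aq^i)$. $(X_i^{(n)})_{i\ge 0}$ is a discrete time Markov chain on $\{0,1,\dots,n\}$ with transition matrix $$P_n(d,r)=\mathbf{1}(d+r\le n)\,q^{-(n-d-r)(n-r)}\frac{(q^{-(n-d)};q)_r(q^{-n};q)_r}{(q^{-r};q)_r},$$ and for real $t\ge 0$, $Y^{(n)}_t=X^{(n)}_{2\lfloor q^{n/2}(q-1)t\rfloor}-n/2$. $(Z^{\mathrm{odd}}_t)_{t\ge 0}$ is the continuous time Markov chain on $\mathbb{Z}+\frac12=\{a+\frac12: a\in\mathbb{Z}\}$ with transition rates $Q(a,a+1)=q^{-a}$, $Q(a,a-1)=q^{a}$, $Q(a,a)=-q^a-q^{-a}$, and $Q(a,b)=0$ otherwise (it has no explosions). *)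

theory Defs
  imports "HOL-Probability.Probability" "HOL-Number_Theory.Prime_Powers"
begin

definition q_pochhammer :: "real \<Rightarrow> real \<Rightarrow> nat \<Rightarrow> real" where
  "q_pochhammer a q r = (\<Prod>i<r. 1 - a * q ^ i)"

text \<open>The exponents are integers, computed in \<^typ>\<open>int\<close> to avoid truncated subtraction.\<close>

definition P_mat :: "real \<Rightarrow> nat \<Rightarrow> nat \<Rightarrow> nat \<Rightarrow> real" where
  "P_mat q n d r =
     (if d + r \<le> n then
        q powi (- ((int n - int d - int r) * (int n - int r)))
        * (q_pochhammer (q powi (- (int n - int d))) q r * q_pochhammer (q powi (- int n)) q r
           / q_pochhammer (q powi (- int r)) q r)
      else 0)"

definition discrete_markov_chain ::
  "'a measure \<Rightarrow> 's set \<Rightarrow> ('s \<Rightarrow> 's \<Rightarrow> real) \<Rightarrow> (nat \<Rightarrow> 'a \<Rightarrow> 's) \<Rightarrow> bool" where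
  "discrete_markov_chain M S P X \<longleftrightarrow>
     prob_space M \<and> countable S \<and>
     (\<forall>i. X i \<in> measurable M (count_space S)) \<and>
     (\<forall>m x. (\<forall>i\<le>Suc m. x i \<in> S) \<and> measure M {\<omega> \<in> space M. \<forall>i\<le>m. X i \<omega> = x i} > 0 \<longrightarrow>
        cond_prob M (\<lambda>\<omega>. X (Suc m) \<omega> = x (Suc m)) (\<lambda>\<omega>. \<forall>i\<le>m. X i \<omega> = x i)
          = P (x m) (x (Suc m)))"

definition transition_function :: "'s set \<Rightarrow> (real \<Rightarrow> 's \<Rightarrow> 's \<Rightarrow> real) \<Rightarrow> bool" where
  "transition_function S p \<longleftrightarrow>
     (\<forall>t\<ge>0. \<forall>x\<in>S. \<forall>y\<in>S. 0 \<le> p t x y) \<and>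
     (\<forall>t\<ge>0. \<forall>x\<in>S. (p t x has_sum 1) S) \<and>
     (\<forall>x\<in>S. \<forall>y\<in>S. p 0 x y = (if x = y then 1 else 0)) \<and>
     (\<forall>s\<ge>0. \<forall>t\<ge>0. \<forall>x\<in>S. \<forall>y\<in>S. ((\<lambda>z. p s x z * p t z y) has_sum p (s + t) x y) S)"

definition has_rates ::
  "'s set \<Rightarrow> (real \<Rightarrow> 's \<Rightarrow> 's \<Rightarrow> real) \<Rightarrow> ('s \<Rightarrow> 's \<Rightarrow> real) \<Rightarrow> bool" where
  "has_rates S p Q \<longleftrightarrow>
     (\<forall>x\<in>S. \<forall>y\<in>S. ((\<lambda>t. p t x y) has_real_derivative Q x y) (at_right 0))"

text \<open>
  A time-homogeneous Markov process with values in the countable set \<open>S\<close> at all times (so there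
  is no explosion), whose transition function has derivative \<open>Q\<close> at time 0. The condition on
  \<open>at_right t\<close> is right-continuity of the paths with respect to the discrete topology on \<open>S\<close>.
\<close>

definition continuous_markov_chain ::
  "'a measure \<Rightarrow> 's set \<Rightarrow> ('s \<Rightarrow> 's \<Rightarrow> real) \<Rightarrow> (real \<Rightarrow> 'a \<Rightarrow> 's) \<Rightarrow> bool" where
  "continuous_markov_chain M S Q Z \<longleftrightarrow>
     prob_space M \<and> countable S \<and>
     (\<forall>t\<ge>0. Z t \<in> measurable M (count_space S)) \<and>
     (AE \<omega> in M. \<forall>t\<ge>0. \<forall>\<^sub>F s in at_right t. Z s \<omega> = Z t \<omega>) \<and>
     (\<exists>p. transition_function S p \<and> has_rates S p Q \<and>
        (\<forall>m s x. 0 \<le> s 0 \<and> strict_mono_on {..Suc m} s \<and> (\<forall>i\<le>Suc m. x i \<in> S) \<and>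
           measure M {\<omega> \<in> space M. \<forall>i\<le>m. Z (s i) \<omega> = x i} > 0 \<longrightarrow>
           cond_prob M (\<lambda>\<omega>. Z (s (Suc m)) \<omega> = x (Suc m)) (\<lambda>\<omega>. \<forall>i\<le>m. Z (s i) \<omega> = x i)
             = p (s (Suc m) - s m) (x m) (x (Suc m))))"

definition half_odd_integers :: "real set" where
  "half_odd_integers = range (\<lambda>a::int. of_int a + 1 / 2)"

definition Q_odd :: "real \<Rightarrow> real \<Rightarrow> real \<Rightarrow> real" where
  "Q_odd q a b =
     (if b = a + 1 then q powr (- a)
      else if b = a - 1 then q powr a
      else if b = a then - (q powr a) - q powr (- a)
      else 0)"

definition Y_proc :: "real \<Rightarrow> nat \<Rightarrow> (nat \<Rightarrow> 'a \<Rightarrow> nat) \<Rightarrow> real \<Rightarrow> 'a \<Rightarrow> real" where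
  "Y_proc q n X t \<omega> = real (X (2 * nat \<lfloor>q powr (real n / 2) * (q - 1) * t\<rfloor>) \<omega>) - real n / 2"

text \<open>The joint law of \<open>(W (t 1), \<dots>, W (t k))\<close>.\<close>

definition fdd :: "'a measure \<Rightarrow> (real \<Rightarrow> 'a \<Rightarrow> real) \<Rightarrow> nat \<Rightarrow> (nat \<Rightarrow> real) \<Rightarrow> (nat \<Rightarrow> real) measure" where
  "fdd M W k t = distr M (\<Pi>\<^sub>M i\<in>{1..k}. borel) (\<lambda>\<omega>. \<lambda>i\<in>{1..k}. W (t i) \<omega>)"

text \<open>Total variation distance of two probability measures on the same \<open>\<sigma>\<close>-algebra.\<close>

definition tv_dist :: "'a measure \<Rightarrow> 'a measure \<Rightarrow> real" where
  "tv_dist \<mu> \<nu> = (SUP A\<in>sets \<mu>. \<bar>measure \<mu> A - measure \<nu> A\<bar>)"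

end

theory Submission
  imports Defs
begin

text \<open>
  The argument compares the two processes from below with one and the same killed chain. Writing
  \<open>d = a + n/2\<close> for the state of \<open>X\<close>, the dominant transition of \<open>P_n\<close> is the reflection
  \<open>d \<mapsto> n - d\<close>. It fails with probability of order \<open>q\<^sup>-\<^sup>d\<close>, and then mostly goes to
  \<open>n - d - 1\<close>. Two steps therefore move \<open>a\<close> to \<open>a + 1\<close> when the first one falls short, and to
  \<open>a - 1\<close> when the second one does. With \<open>h = 1 / (q\<^sup>n\<^sup>/\<^sup>2 (q - 1))\<close> these probabilities are
  \<open>h q\<^sup>-\<^sup>a\<close> and \<open>h q\<^sup>a\<close> to first order, so the two-step kernel is at least \<open>I + h (Q - \<delta>)\<close>
  entrywise on every finite set of states, for every \<open>\<delta> > 0\<close> and large \<open>n\<close>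
  (\<open>eventually_two_step_ge\<close>).

  The transition function of \<open>Z\<close> at time \<open>t/m\<close> obeys the same local lower bound, by the definition
  of its rates. Hence both the \<open>m\<close>-fold two-step kernel and \<open>p t\<close> dominate the \<open>m\<close>-th power of the
  Euler kernel \<open>max 0 (I + h (Q - \<delta>))\<close>, killed outside a finite set \<open>B\<close>. The function \<open>\<bar>a\<bar>\<close> has
  bounded drift under \<open>Q\<close>; so, if \<open>B\<close> is a large level set of it, the killed chain keeps nearly all of its
  mass up to time \<open>t\<close>. Since \<open>p t x\<close> has total mass 1, it can exceed the killed chain only by
  little, and therefore the two-step kernel is asymptotically at least \<open>p t\<close>
  (\<open>eventually_ge_transition_function\<close>).

  By the Markov property the point masses of the finite-dimensional laws are products of such
  kernels, so in the limit they are at least those of \<open>Z\<close>. For probability measures, with a limit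
  carried by a countable set, this forces convergence in total variation
  (\<open>tv_dist_tendsto_0\<close>), as no mass is left over.
\<close>

section \<open>Powers of a kernel\<close>

primrec kernel_pow :: "('s \<Rightarrow> 's \<Rightarrow> real) \<Rightarrow> 's set \<Rightarrow> nat \<Rightarrow> 's \<Rightarrow> 's \<Rightarrow> real" where
  "kernel_pow K B 0 x y = (if x = y then 1 else 0)"
| "kernel_pow K B (Suc m) x y = (\<Sum>z\<in>B. K x z * kernel_pow K B m z y)"

lemma kernel_pow_nonneg:
  assumes "\<And>x y. x \<in> B \<Longrightarrow> y \<in> B \<Longrightarrow> 0 \<le> K x y" "x \<in> B"
  shows "0 \<le> kernel_pow K B m x y"
  using assms(2) by (induction m arbitrary: x) (auto intro!: sum_nonneg mult_nonneg_nonneg assms(1))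

lemma kernel_pow_add:
  assumes "finite B" "x \<in> B"
  shows "kernel_pow K B (i + j) x y = (\<Sum>z\<in>B. kernel_pow K B i x z * kernel_pow K B j z y)"
  using assms(2)
proof (induction i arbitrary: x)
  case 0
  have "(\<Sum>z\<in>B. kernel_pow K B 0 x z * kernel_pow K B j z y)
      = (\<Sum>z\<in>B. if x = z then kernel_pow K B j z y else 0)"
    by (intro sum.cong) auto
  then show ?case using 0 assms(1) by simp
next
  case (Suc i)
  have "kernel_pow K B (Suc i + j) x y
      = (\<Sum>w\<in>B. K x w * (\<Sum>z\<in>B. kernel_pow K B i w z * kernel_pow K B j z y))"
    using Suc by simp
  also have "\<dots> = (\<Sum>z\<in>B. \<Sum>w\<in>B. K x w * (kernel_pow K B i w z * kernel_pow K B j z y))"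
    unfolding sum_distrib_left by (rule sum.swap)
  also have "\<dots> = (\<Sum>z\<in>B. kernel_pow K B (Suc i) x z * kernel_pow K B j z y)"
    by (simp add: sum_distrib_left sum_distrib_right mult_ac)
  finally show ?case .
qed

text \<open>
  The part of the Chapman-Kolmogorov equations that survives when the intermediate states are
  confined to \<open>B\<close>. It holds for the powers of a kernel on a larger space as well as for the
  skeleton of a transition function, and it is all that a comparison from below uses.
\<close>

definition superconvolutive :: "'s set \<Rightarrow> (nat \<Rightarrow> 's \<Rightarrow> 's \<Rightarrow> real) \<Rightarrow> bool" where
  "superconvolutive B U \<longleftrightarrow>
     (\<forall>x\<in>B. 1 \<le> U 0 x x) \<and>
     (\<forall>j. \<forall>x\<in>B. \<forall>y\<in>B. 0 \<le> U j x y) \<and>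
     (\<forall>j. \<forall>x\<in>B. \<forall>y\<in>B. (\<Sum>c\<in>B. U 1 x c * U j c y) \<le> U (Suc j) x y)"

lemma kernel_pow_le_superconvolutive:
  assumes U: "superconvolutive B U"
    and le: "\<And>x y. x \<in> B \<Longrightarrow> y \<in> B \<Longrightarrow> 0 \<le> K x y \<and> K x y \<le> U 1 x y"
    and "x \<in> B" "y \<in> B"
  shows "kernel_pow K B m x y \<le> U m x y"
  using assms(3,4)
proof (induction m arbitrary: x)
  case 0
  then show ?case using U by (auto simp: superconvolutive_def)
next
  case (Suc m)
  have "kernel_pow K B (Suc m) x y \<le> (\<Sum>c\<in>B. U 1 x c * U m c y)"
    unfolding kernel_pow.simps
    using Suc le U
    by (intro sum_mono mult_mono) (auto intro!: kernel_pow_nonneg simp: superconvolutive_def)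
  also have "\<dots> \<le> U (Suc m) x y"
    using U Suc.prems by (auto simp: superconvolutive_def)
  finally show ?case .
qed

section \<open>Rates with a Lyapunov function\<close>

text \<open>
  Conservative rates with finitely many jump targets \<open>nbh x\<close> from each state, and a Lyapunov function
  \<open>V\<close> with finite level sets whose drift is at most \<open>C\<close>. The drift bound is what prevents
  explosion: to leave a level set quickly, a path would have to raise \<open>V\<close> faster than \<open>C\<close> allows on average.
\<close>

locale lyapunov_rates =
  fixes S :: "'s set" and Q :: "'s \<Rightarrow> 's \<Rightarrow> real" and nbh :: "'s \<Rightarrow> 's set"
    and V :: "'s \<Rightarrow> real" and C :: real
  assumes finite_nbh: "x \<in> S \<Longrightarrow> finite (nbh x)"
    and nbh_subset: "x \<in> S \<Longrightarrow> nbh x \<subseteq> S"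
    and self_nbh: "x \<in> S \<Longrightarrow> x \<in> nbh x"
    and rate_outside_nbh: "x \<in> S \<Longrightarrow> y \<in> S \<Longrightarrow> y \<notin> nbh x \<Longrightarrow> Q x y = 0"
    and rate_nonneg: "x \<in> S \<Longrightarrow> y \<in> S \<Longrightarrow> x \<noteq> y \<Longrightarrow> 0 \<le> Q x y"
    and rate_conservative: "x \<in> S \<Longrightarrow> (\<Sum>y\<in>nbh x. Q x y) = 0"
    and V_nonneg: "x \<in> S \<Longrightarrow> 0 \<le> V x"
    and C_nonneg: "0 \<le> C"
    and drift: "x \<in> S \<Longrightarrow> (\<Sum>y\<in>nbh x. Q x y * V y) \<le> C"
    and finite_level: "finite {x \<in> S. V x \<le> R}"
begin

definition level :: "real \<Rightarrow> 's set" where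
  "level R = {x \<in> S. V x \<le> R}"

lemma level_finite [simp]: "finite (level R)" and level_subset: "level R \<subseteq> S"
  using finite_level by (auto simp: level_def)

text \<open>
  One Euler step of length \<open>h\<close> for the rates, lowered by a slack \<open>h * d\<close> which absorbs every error
  of order \<open>o(h)\<close> in the kernels that it is compared with. The truncation at 0 keeps the
  powers monotone in the kernel.
\<close>

definition euler :: "real \<Rightarrow> real \<Rightarrow> 's \<Rightarrow> 's \<Rightarrow> real" where
  "euler h d x y = max 0 ((if x = y then 1 else 0) + h * (Q x y - d))"

lemma euler_nonneg [simp]: "0 \<le> euler h d x y"
  by (simp add: euler_def)

text \<open>
  Killing outside \<open>B\<close> replaces \<open>w\<close> by 0 there. Where \<open>w\<close> is nonpositive this can only increase
  the generator at points of \<open>B\<close>, because the rates that lead out of \<open>B\<close> are nonnegative.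
\<close>

lemma sum_rates_ge_nbh:
  assumes x: "x \<in> B" and B: "finite B" "B \<subseteq> S" and w: "\<And>z. z \<in> nbh x \<Longrightarrow> z \<notin> B \<Longrightarrow> w z \<le> 0"
  shows "(\<Sum>z\<in>nbh x. Q x z * w z) \<le> (\<Sum>z\<in>B. Q x z * w z)"
proof -
  have xS: "x \<in> S" using x B by auto
  have "(\<Sum>z\<in>nbh x. Q x z * w z)
      = (\<Sum>z\<in>nbh x \<inter> B. Q x z * w z) + (\<Sum>z\<in>nbh x - B. Q x z * w z)"
    using finite_nbh[OF xS] by (subst sum.Int_Diff[of _ _ B]) auto
  also have "(\<Sum>z\<in>nbh x - B. Q x z * w z) \<le> 0"
    using w x nbh_subset[OF xS] xS
    by (intro sum_nonpos mult_nonneg_nonpos rate_nonneg) auto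
  also have "(\<Sum>z\<in>nbh x \<inter> B. Q x z * w z) = (\<Sum>z\<in>B. Q x z * w z)"
    using B xS rate_outside_nbh by (intro sum.mono_neutral_left) auto
  finally show ?thesis by simp
qed

lemma euler_row_le_1:
  assumes x: "x \<in> B" and B: "finite B" "B \<subseteq> S" and "0 \<le> h" "0 \<le> d" and hQ: "h * (- Q x x) \<le> 1"
  shows "(\<Sum>y\<in>B. euler h d x y) \<le> 1"
proof -
  have xS: "x \<in> S" using x B by auto
  have "(\<Sum>y\<in>B. euler h d x y) \<le> (\<Sum>y\<in>B. (if x = y then 1 else 0) + h * Q x y)"
  proof (rule sum_mono)
    fix y assume y: "y \<in> B"
    have "0 \<le> (if x = y then 1 else 0) + h * Q x y"
      using rate_nonneg[of x y] y B xS hQ \<open>0 \<le> h\<close> by (auto intro!: mult_nonneg_nonneg)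
    moreover have "0 \<le> h * d" using assms by simp
    ultimately show "euler h d x y \<le> (if x = y then 1 else 0) + h * Q x y"
      by (auto simp: euler_def right_diff_distrib)
  qed
  also have "\<dots> = 1 + h * (\<Sum>y\<in>B. Q x y)"
    using x B by (simp add: sum.distrib sum_distrib_left)
  also have "(\<Sum>y\<in>B. Q x y) \<le> 0"
    using sum_rates_ge_nbh[OF x B, of "\<lambda>_. -1"] rate_conservative[OF xS]
    by (simp add: sum_negf)
  then have "1 + h * (\<Sum>y\<in>B. Q x y) \<le> 1"
    using \<open>0 \<le> h\<close> by (simp add: mult_nonneg_nonpos)
  finally show ?thesis .
qed

lemma euler_mass_le_1:
  assumes B: "finite B" "B \<subseteq> S" and h: "0 \<le> h" "0 \<le> d" and hQ: "\<And>x. x \<in> B \<Longrightarrow> h * (- Q x x) \<le> 1"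
    and "x \<in> B"
  shows "(\<Sum>y\<in>B. kernel_pow (euler h d) B m x y) \<le> 1"
  using \<open>x \<in> B\<close>
proof (induction m arbitrary: x)
  case 0
  then show ?case using B by simp
next
  case (Suc m)
  have "(\<Sum>y\<in>B. kernel_pow (euler h d) B (Suc m) x y)
      = (\<Sum>z\<in>B. euler h d x z * (\<Sum>y\<in>B. kernel_pow (euler h d) B m z y))"
    by (simp add: sum_distrib_left) (rule sum.swap)
  also have "\<dots> \<le> (\<Sum>z\<in>B. euler h d x z * 1)"
    using Suc.IH by (intro sum_mono mult_left_mono) auto
  also have "\<dots> \<le> 1"
    using euler_row_le_1[OF Suc.prems B h hQ[OF Suc.prems]] by simp
  finally show ?case .
qed

text \<open>
  The right-hand side is the mass that the killed chain still carries after \<open>m\<close> steps. The bound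
  follows from a discrete maximum principle: the left-hand side, as a function of \<open>m\<close> and \<open>x\<close>, is
  nonpositive outside the level set and a subsolution of the recursion that the mass satisfies, the
  decrease \<open>h * C / R\<close> per step paying for the drift of \<open>V\<close> and \<open>h * d * card B\<close> for the slack.
\<close>

lemma euler_mass_ge:
  fixes R h d :: real
  defines "B \<equiv> level R"
  assumes R: "0 < R" and h: "0 \<le> h" "0 \<le> d" and hQ: "\<And>x. x \<in> B \<Longrightarrow> h * (- Q x x) \<le> 1"
    and "x \<in> B"
  shows "1 - (V x + real m * h * C) / R - real m * h * d * real (card B)
     \<le> (\<Sum>y\<in>B. kernel_pow (euler h d) B m x y)"
  using \<open>x \<in> B\<close>
proof (induction m arbitrary: x)
  case 0
  have "0 \<le> V x / R" using 0 R V_nonneg[of x] by (auto simp: B_def level_def)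
  then show ?case using 0 by (simp add: B_def)
next
  case (Suc m)
  have B: "finite B" "B \<subseteq> S" using level_subset by (auto simp: B_def)
  have xS: "x \<in> S" using Suc B by auto
  define u where "u z = (\<Sum>y\<in>B. kernel_pow (euler h d) B m z y)" for z
  define w where "w z = 1 - (V z + real m * h * C) / R - real m * h * d * real (card B)" for z
  have u0: "0 \<le> u z" if "z \<in> B" for z
    unfolding u_def using that by (intro sum_nonneg kernel_pow_nonneg) auto
  have u1: "u z \<le> 1" if "z \<in> B" for z
    unfolding u_def using euler_mass_le_1[OF B h hQ that] by simp
  have uw: "w z \<le> u z" if "z \<in> B" for z
    unfolding u_def w_def using Suc.IH[OF that] .
  have w_out: "w z \<le> 0" if "z \<in> nbh x" "z \<notin> B" for z
  proof -
    have "R < V z" using that nbh_subset[OF xS] by (auto simp: B_def level_def)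
    then have "1 \<le> V z / R" using R by simp
    moreover have "0 \<le> real m * h * C / R" using R h C_nonneg by simp
    moreover have "0 \<le> real m * h * d * real (card B)" using h by simp
    ultimately show ?thesis by (simp add: w_def add_divide_distrib)
  qed
  have "w x - h * C / R - h * d * real (card B)
      \<le> w x + h * (\<Sum>z\<in>B. Q x z * w z) - h * d * (\<Sum>z\<in>B. u z)"
  proof -
    have "(\<Sum>z\<in>nbh x. Q x z * w z)
        = (\<Sum>z\<in>nbh x. Q x z * (1 - real m * h * C / R - real m * h * d * real (card B)) - Q x z * V z / R)"
      by (intro sum.cong refl) (simp add: w_def algebra_simps add_divide_distrib)
    also have "\<dots> = - (\<Sum>z\<in>nbh x. Q x z * V z) / R"
      using rate_conservative[OF xS]
      by (simp add: sum_subtractf sum_distrib_right[symmetric] sum_divide_distrib[symmetric])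
    also have "\<dots> \<ge> - C / R"
      using drift[OF xS] R by (simp add: divide_right_mono)
    finally have "- C / R \<le> (\<Sum>z\<in>B. Q x z * w z)"
      using sum_rates_ge_nbh[OF Suc.prems B, of w] w_out by simp
    then have "h * (- C / R) \<le> h * (\<Sum>z\<in>B. Q x z * w z)"
      using h by (intro mult_left_mono) auto
    moreover have "(\<Sum>z\<in>B. u z) \<le> real (card B)"
      using sum_bounded_above[of B u 1] u1 by simp
    then have "h * d * (\<Sum>z\<in>B. u z) \<le> h * d * real (card B)"
      using h by (intro mult_left_mono) auto
    ultimately show ?thesis by simp
  qed
  also have "w x + h * (\<Sum>z\<in>B. Q x z * w z) = (\<Sum>z\<in>B. ((if x = z then 1 else 0) + h * Q x z) * w z)"
  proof -
    have "(\<Sum>z\<in>B. (if x = z then 1 else 0) * w z) = w x"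
      using Suc.prems B by (simp add: if_distrib[of "\<lambda>a. a * _"] cong: if_cong)
    then show ?thesis
      by (simp add: distrib_right sum.distrib sum_distrib_left mult.assoc)
  qed
  also have "\<dots> \<le> (\<Sum>z\<in>B. ((if x = z then 1 else 0) + h * Q x z) * u z)"
  proof (intro sum_mono mult_left_mono uw)
    fix z assume "z \<in> B"
    then show "0 \<le> (if x = z then 1 else 0) + h * Q x z"
      using rate_nonneg[of x z] B xS hQ[of x] h Suc.prems by (auto intro!: mult_nonneg_nonneg)
  qed
  also have "(\<Sum>z\<in>B. ((if x = z then 1 else 0) + h * Q x z) * u z) - h * d * (\<Sum>z\<in>B. u z)
      = (\<Sum>z\<in>B. ((if x = z then 1 else 0) + h * (Q x z - d)) * u z)"
    by (simp add: sum_distrib_left sum_subtractf[symmetric] algebra_simps)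
  also have "\<dots> \<le> (\<Sum>z\<in>B. euler h d x z * u z)"
    by (intro sum_mono mult_right_mono u0) (auto simp: euler_def)
  also have "\<dots> = (\<Sum>y\<in>B. kernel_pow (euler h d) B (Suc m) x y)"
    by (simp add: u_def sum_distrib_left) (rule sum.swap)
  also have "w x - h * C / R - h * d * real (card B)
      = 1 - (V x + real (Suc m) * h * C) / R - real (Suc m) * h * d * real (card B)"
    by (simp add: w_def algebra_simps add_divide_distrib)
  finally show ?case by simp
qed

lemma eventually_euler_le:
  fixes U :: "'n \<Rightarrow> nat \<Rightarrow> 's \<Rightarrow> 's \<Rightarrow> real"
  assumes U: "\<And>B. finite B \<Longrightarrow> B \<subseteq> S \<Longrightarrow> \<forall>\<^sub>F n in F. superconvolutive B (U n)"
    and loc: "\<And>x y e. x \<in> S \<Longrightarrow> y \<in> S \<Longrightarrow> 0 < e \<Longrightarrow>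
        \<forall>\<^sub>F n in F. (if x = y then 1 else 0) + h n * (Q x y - e) \<le> U n 1 x y"
    and "0 < d"
  shows "\<forall>\<^sub>F n in F. \<forall>x\<in>level R. \<forall>y\<in>level R. \<forall>m.
     kernel_pow (euler (h n) d) (level R) m x y \<le> U n m x y"
proof -
  have "\<forall>\<^sub>F n in F. \<forall>x\<in>level R. \<forall>y\<in>level R.
      (if x = y then 1 else 0) + h n * (Q x y - d) \<le> U n 1 x y"
    using level_subset \<open>0 < d\<close> by (intro eventually_ball_finite ballI level_finite loc) auto
  moreover have "\<forall>\<^sub>F n in F. superconvolutive (level R) (U n)"
    using level_subset by (intro U) auto
  ultimately show ?thesis
  proof eventually_elim
    case (elim n)
    have "0 \<le> euler (h n) d x y \<and> euler (h n) d x y \<le> U n 1 x y"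
      if "x \<in> level R" "y \<in> level R" for x y
      using that elim by (auto simp: euler_def superconvolutive_def)
    then show ?case
      using kernel_pow_le_superconvolutive[OF elim(2)] by blast
  qed
qed

text \<open>
  The killed Euler chain lies below \<open>U\<close> and below the skeleton of \<open>p\<close> with step \<open>t / m n\<close>, and it
  loses at most mass \<open>e\<close>. Since \<open>p t x\<close> sums to 1, whatever \<open>p t x y\<close> has in excess of
  the killed chain is at most \<open>e\<close>, and \<open>U\<close> inherits the bound.
\<close>

theorem eventually_ge_transition_function:
  fixes U :: "'n \<Rightarrow> nat \<Rightarrow> 's \<Rightarrow> 's \<Rightarrow> real" and h :: "'n \<Rightarrow> real" and m :: "'n \<Rightarrow> nat"
  assumes p: "transition_function S p" and rates: "has_rates S p Q"
    and h0: "filterlim h (at_right 0) F" and mh: "((\<lambda>n. real (m n) * h n) \<longlongrightarrow> t) F" and t: "0 < t"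
    and U: "\<And>B. finite B \<Longrightarrow> B \<subseteq> S \<Longrightarrow> \<forall>\<^sub>F n in F. superconvolutive B (U n)"
    and loc: "\<And>x y e. x \<in> S \<Longrightarrow> y \<in> S \<Longrightarrow> 0 < e \<Longrightarrow>
        \<forall>\<^sub>F n in F. (if x = y then 1 else 0) + h n * (Q x y - e) \<le> U n 1 x y"
    and x: "x \<in> S" and y: "y \<in> S" and e: "0 < e"
  shows "\<forall>\<^sub>F n in F. p t x y - e \<le> U n (m n) x y"
proof -
  have hlim: "(h \<longlongrightarrow> 0) F" and hpos: "\<forall>\<^sub>F n in F. 0 < h n"
    using h0 by (auto simp: filterlim_at elim: eventually_mono)
  have p_nonneg: "0 \<le> p s a b" if "0 \<le> s" "a \<in> S" "b \<in> S" for s a b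
    using p that by (auto simp: transition_function_def)
  have p_0: "p 0 a b = (if a = b then 1 else 0)" if "a \<in> S" "b \<in> S" for a b
    using p that by (auto simp: transition_function_def)
  have p_conv: "((\<lambda>z. p s a z * p r z b) has_sum p (s + r) a b) S"
    if "0 \<le> s" "0 \<le> r" "a \<in> S" "b \<in> S" for s r a b
    using p that by (auto simp: transition_function_def)
  have mpos: "\<forall>\<^sub>F n in F. 0 < m n"
    using order_tendstoD(1)[OF mh t] by eventually_elim (auto intro: gr0I)
  \<comment> \<open>This step makes \<open>m n\<close> steps end exactly at time \<open>t\<close>; it agrees with \<open>h n\<close> only to first
      order, which the slack in the Euler kernel absorbs.\<close>
  define s where "s n = t / real (m n)" for n
  have s_ratio: "((\<lambda>n. s n / h n) \<longlongrightarrow> 1) F"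
  proof -
    have "((\<lambda>n. t / (real (m n) * h n)) \<longlongrightarrow> t / t) F"
      using t by (intro tendsto_intros mh) auto
    then show ?thesis using t by (simp add: s_def field_simps)
  qed
  have s_lim: "filterlim s (at_right 0) F"
  proof -
    have "((\<lambda>n. s n / h n * h n) \<longlongrightarrow> 1 * 0) F"
      by (intro tendsto_intros s_ratio hlim)
    then have "(s \<longlongrightarrow> 0) F"
      by (rule Lim_transform_eventually[THEN tendsto_eq_rhs])
        (use hpos in \<open>auto elim: eventually_mono\<close>)
    moreover have "\<forall>\<^sub>F n in F. 0 < s n"
      using mpos by eventually_elim (use t in \<open>auto simp: s_def\<close>)
    ultimately show ?thesis
      by (auto simp: filterlim_at elim: eventually_mono)
  qed
  have p_super: "\<forall>\<^sub>F n in F. superconvolutive B (\<lambda>j. p (real j * s n))"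
    if B: "finite B" "B \<subseteq> S" for B
    using mpos
  proof eventually_elim
    case (elim n)
    have s0: "0 \<le> s n" using t by (simp add: s_def)
    have "(\<Sum>c\<in>B. p (s n) a c * p (real j * s n) c b) \<le> p (s n + real j * s n) a b"
      if "a \<in> B" "b \<in> B" for j a b
    proof (rule finite_sum_le_has_sum[OF p_conv B])
      show "0 \<le> s n" by fact
      show "0 \<le> real j * s n" using s0 by simp
      show "a \<in> S" "b \<in> S" using that B by auto
      show "0 \<le> p (s n) a z * p (real j * s n) z b" if "z \<in> S - B" for z
        using that \<open>a \<in> S\<close> \<open>b \<in> S\<close> s0 by (intro mult_nonneg_nonneg p_nonneg) auto
    qed
    moreover have "0 \<le> p (real j * s n) a b" if "a \<in> B" "b \<in> B" for j a b
      using s0 that B by (intro p_nonneg) auto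
    ultimately show ?case
      using p_0 B by (auto simp: superconvolutive_def algebra_simps)
  qed
  have p_loc: "\<forall>\<^sub>F n in F. (if a = b then 1 else 0) + h n * (Q a b - c) \<le> p (real 1 * s n) a b"
    if "a \<in> S" "b \<in> S" "0 < c" for a b c
  proof -
    have "((\<lambda>r. (p r a b - p 0 a b) / (r - 0)) \<longlongrightarrow> Q a b) (at_right 0)"
      using rates that unfolding has_rates_def has_field_derivative_iff by blast
    then have "((\<lambda>n. (p (s n) a b - p 0 a b) / (s n - 0)) \<longlongrightarrow> Q a b) F"
      by (rule filterlim_compose[OF _ s_lim])
    then have "((\<lambda>n. (p (s n) a b - p 0 a b) / (s n - 0) * (s n / h n)) \<longlongrightarrow> Q a b * 1) F"
      by (intro tendsto_mult s_ratio)
    then have "\<forall>\<^sub>F n in F. Q a b - c < (p (s n) a b - p 0 a b) / (s n - 0) * (s n / h n)"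
      using \<open>0 < c\<close> by (intro order_tendstoD(1)) auto
    moreover have "\<forall>\<^sub>F n in F. 0 < s n"
      using mpos by eventually_elim (use t in \<open>auto simp: s_def\<close>)
    ultimately show ?thesis using hpos
    proof eventually_elim
      case (elim n)
      then have "Q a b - c < (p (s n) a b - p 0 a b) / h n" by simp
      then have "h n * (Q a b - c) < p (s n) a b - p 0 a b"
        using elim(3) by (simp add: field_simps)
      then show ?case using p_0[OF that(1,2)] by (simp add: algebra_simps)
    qed
  qed
  \<comment> \<open>The level \<open>R\<close> keeps the loss from the drift and \<open>d\<close> the loss from the slack below
      \<open>e / 2\<close> each; the total time \<open>m n * h n\<close> is eventually below \<open>t + 1\<close>.\<close>
  define R where "R = max (max (V x) (V y)) (1 + 2 * (V x + (t + 1) * C) / e)"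
  define B where "B = level R"
  define d where "d = e / (2 * (t + 1) * (1 + real (card B)))"
  have xB: "x \<in> B" and yB: "y \<in> B" using x y by (auto simp: B_def level_def R_def)
  have BS: "finite B" "B \<subseteq> S" using level_subset by (auto simp: B_def)
  have d: "0 < d" using e t by (simp add: d_def)
  have VC: "0 \<le> V x + (t + 1) * C" using V_nonneg[OF x] C_nonneg t by simp
  have R: "0 < R" using VC e by (auto simp: R_def intro!: max.strict_coboundedI2 add_pos_nonneg)
  have R_bound: "(V x + (t + 1) * C) / R \<le> e / 2"
  proof -
    have "2 * (V x + (t + 1) * C) / e \<le> R" by (simp add: R_def)
    then show ?thesis using R e by (simp add: field_simps)
  qed
  have d_bound: "(t + 1) * d * real (card B) \<le> e / 2"
  proof -
    have "(t + 1) * d * real (card B) = e / 2 * (real (card B) / (1 + real (card B)))"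
      using t by (simp add: d_def divide_simps) (simp add: algebra_simps)
    also have "\<dots> \<le> e / 2 * 1"
      using e by (intro mult_left_mono) (auto simp: divide_simps)
    finally show ?thesis by simp
  qed
  have "\<forall>\<^sub>F n in F. real (m n) * h n < t + 1"
    by (rule order_tendstoD(2)[OF mh]) simp
  moreover have "\<forall>\<^sub>F n in F. \<forall>a\<in>B. h n * (- Q a a) \<le> 1"
  proof (intro eventually_ball_finite ballI BS)
    fix a
    have "((\<lambda>n. h n * (- Q a a)) \<longlongrightarrow> 0 * (- Q a a)) F" by (intro tendsto_intros hlim)
    then have "\<forall>\<^sub>F n in F. h n * (- Q a a) < 1" by (intro order_tendstoD(2)) auto
    then show "\<forall>\<^sub>F n in F. h n * (- Q a a) \<le> 1" by eventually_elim simp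
  qed
  moreover have "\<forall>\<^sub>F n in F. \<forall>a\<in>B. \<forall>b\<in>B. \<forall>j. kernel_pow (euler (h n) d) B j a b \<le> U n j a b"
    unfolding B_def by (rule eventually_euler_le[OF U loc d])
  moreover have "\<forall>\<^sub>F n in F. \<forall>a\<in>B. \<forall>b\<in>B. \<forall>j.
      kernel_pow (euler (h n) d) B j a b \<le> p (real j * s n) a b"
    unfolding B_def by (rule eventually_euler_le[OF p_super p_loc d])
  ultimately show ?thesis using mpos hpos
  proof eventually_elim
    case (elim n)
    let ?E = "kernel_pow (euler (h n) d) B (m n) x"
    have mh0: "0 \<le> real (m n) * h n" using elim by simp
    have mass: "1 - e \<le> (\<Sum>z\<in>B. ?E z)"
    proof -
      have "1 - (V x + real (m n) * h n * C) / R - real (m n) * h n * d * real (card B) \<le> (\<Sum>z\<in>B. ?E z)"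
        using elim xB d unfolding B_def by (intro euler_mass_ge R) auto
      moreover have "(V x + real (m n) * h n * C) / R \<le> (V x + (t + 1) * C) / R"
        using elim R C_nonneg by (intro divide_right_mono add_left_mono mult_right_mono) auto
      moreover have "real (m n) * h n * (d * real (card B)) \<le> (t + 1) * (d * real (card B))"
        using elim d by (intro mult_right_mono) auto
      ultimately show ?thesis using R_bound d_bound unfolding mult.assoc[symmetric] by linarith
    qed
    have ms: "real (m n) * s n = t" using elim by (simp add: s_def)
    have "?E z \<le> p t x z" if "z \<in> B" for z
      using elim(4) that xB ms by metis
    then have "(\<Sum>z\<in>B - {y}. ?E z) \<le> (\<Sum>z\<in>B - {y}. p t x z)"
      by (intro sum_mono) auto
    moreover have "(\<Sum>z\<in>B. p t x z) \<le> 1"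
    proof (rule finite_sum_le_has_sum[OF _ BS])
      show "(p t x has_sum 1) S" using p x t by (auto simp: transition_function_def)
    qed (use p_nonneg t x in auto)
    ultimately have "p t x y - e \<le> ?E y"
      using mass BS yB by (simp add: sum.remove[of B y])
    also have "\<dots> \<le> U n (m n) x y" using elim(3) xB yB by blast
    finally show ?case .
  qed
qed

end

section \<open>Transition probabilities of the discrete chain over two steps\<close>

lemma powi_neg_le_1:
  fixes q :: real
  assumes "1 \<le> q" "k \<le> 0"
  shows "q powi k \<le> 1"
  using power_int_increasing[OF assms(2,1)] by simp

lemma q_pochhammer_neg_power:
  assumes "q > 0"
  shows "q_pochhammer (q powi (- int N)) q r = (\<Prod>i<r. 1 - q powi (int i - int N))"
  unfolding q_pochhammer_def
proof (intro prod.cong refl)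
  fix i
  have "q powi (int i - int N) = q powi int i * q powi (- int N)"
    using assms by (subst power_int_add[symmetric]) auto
  then show "1 - q powi (- int N) * q ^ i = 1 - q powi (int i - int N)"
    by simp
qed

lemma q_pochhammer_neg_power_pos:
  assumes "q > 1" "r \<le> N"
  shows "0 < q_pochhammer (q powi (- int N)) q r"
proof -
  have "q powi (int i - int N) < 1" if "i < r" for i
    using assms that power_int_strict_increasing[of "int i - int N" 0 q] by simp
  then show ?thesis using assms by (auto simp: q_pochhammer_neg_power intro!: prod_pos)
qed

text \<open>
  The product is at least 1 minus the sum of a geometric series, by the Weierstrass inequality.
\<close>

lemma q_pochhammer_neg_power_ge:
  assumes "q > 1" "r \<le> N"
  shows "1 - q powi (int r - int N) / (q - 1) \<le> q_pochhammer (q powi (- int N)) q r"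
proof -
  have "(\<Sum>i<r. q powi (int i - int N)) = (\<Sum>i<r. q powi (- int N) * q ^ i)"
  proof (intro sum.cong refl)
    fix i
    show "q powi (int i - int N) = q powi (- int N) * q ^ i"
      using assms power_int_add[of q "- int N" "int i"] by (simp add: algebra_simps)
  qed
  also have "\<dots> = q powi (- int N) * ((q ^ r - 1) / (q - 1))"
    using assms by (simp add: sum_distrib_left[symmetric] sum_gp_strict divide_simps) (simp add: algebra_simps)
  also have "\<dots> \<le> q powi (- int N) * (q ^ r / (q - 1))"
    using assms by (intro mult_left_mono divide_right_mono) auto
  also have "\<dots> = q powi (int r - int N) / (q - 1)"
    using assms power_int_add[of q "- int N" "int r"] by (simp add: algebra_simps)
  finally have "1 - q powi (int r - int N) / (q - 1) \<le> 1 - (\<Sum>i<r. q powi (int i - int N))"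
    by simp
  also have "\<dots> \<le> (\<Prod>i<r. 1 - q powi (int i - int N))"
    using assms by (intro Weierstrass_prod_ineq) (auto intro!: powi_neg_le_1)
  finally show ?thesis using assms by (simp add: q_pochhammer_neg_power)
qed

lemma P_mat_nonneg:
  assumes "q > 1"
  shows "0 \<le> P_mat q n d r"
proof (cases "d + r \<le> n")
  case True
  have eq: "q powi (- (int n - int d)) = q powi (- int (n - d))"
    using True by (simp add: of_nat_diff)
  have "0 < q_pochhammer (q powi (- (int n - int d))) q r"
    unfolding eq using True assms by (intro q_pochhammer_neg_power_pos) auto
  moreover have "0 < q_pochhammer (q powi (- int n)) q r" "0 < q_pochhammer (q powi (- int r)) q r"
    using True assms by (auto intro!: q_pochhammer_neg_power_pos)
  ultimately show ?thesis
    using assms by (auto simp: P_mat_def intro!: mult_nonneg_nonneg divide_nonneg_nonneg)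
qed (simp add: P_mat_def)

text \<open>
  At \<open>r = n - d\<close> the prefactor is 1 and the first and third product in \<open>P_mat\<close> cancel.
\<close>

lemma P_mat_reflect_ge:
  assumes "q > 1" "d \<le> n"
  shows "1 - q powi (- int d) / (q - 1) \<le> P_mat q n d (n - d)"
proof -
  have eq: "q powi (- (int n - int d)) = q powi (- int (n - d))"
    using assms by (simp add: of_nat_diff)
  have "P_mat q n d (n - d) = q_pochhammer (q powi (- int n)) q (n - d)"
    unfolding P_mat_def eq
    using assms q_pochhammer_neg_power_pos[of q "n - d" "n - d"] by (simp add: of_nat_diff)
  then show ?thesis
    using q_pochhammer_neg_power_ge[of q "n - d" n] assms by (simp add: of_nat_diff)
qed

text \<open>
  Both sides are the product of \<open>1 - q\<^sup>-\<^sup>j\<close> over \<open>1 \<le> j \<le> r + 1\<close>, with either the smallest or the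
  largest \<open>j\<close> split off.
\<close>

lemma q_pochhammer_neg_power_shift:
  assumes "q > 1"
  shows "q_pochhammer (q powi (- int (Suc r))) q r * (1 - q powi (- 1))
       = (1 - q powi (- int (Suc r))) * q_pochhammer (q powi (- int r)) q r"
proof -
  have "(\<Prod>i<Suc r. 1 - q powi (int i - int (Suc r)))
      = q_pochhammer (q powi (- int (Suc r))) q r * (1 - q powi (int r - int (Suc r)))"
    using assms by (subst q_pochhammer_neg_power) (auto simp del: of_nat_Suc)
  also have "int r - int (Suc r) = - 1" by simp
  finally have "(\<Prod>i<Suc r. 1 - q powi (int i - int (Suc r)))
      = q_pochhammer (q powi (- int (Suc r))) q r * (1 - q powi (- 1))" .
  moreover have "(\<Prod>i<Suc r. 1 - q powi (int i - int (Suc r)))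
      = (1 - q powi (- int (Suc r))) * q_pochhammer (q powi (- int r)) q r"
    using assms by (subst prod.lessThan_Suc_shift, subst q_pochhammer_neg_power) auto
  ultimately show ?thesis by (rule trans[OF sym])
qed

text \<open>
  The transition that falls short of the reflection by one. The quotient of the first and third product
  telescopes to \<open>(1 - q\<^sup>-\<^sup>(\<^sup>n\<^sup>-\<^sup>d\<^sup>)) / (1 - q\<^sup>-\<^sup>1)\<close>.
\<close>

lemma P_mat_defect_ge:
  assumes "q > 1" "d < n"
  shows "q powi (- int d) / (q - 1) * (1 - q powi (- int (n - d))) * (1 - q powi (- int (Suc d)) / (q - 1))
     \<le> P_mat q n d (n - Suc d)"
proof -
  define r where "r = n - Suc d"
  have n: "n = d + Suc r" using assms by (simp add: r_def)
  have nd: "n - d = Suc r" using n by simp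
  have eq: "q powi (- (int n - int d)) = q powi (- int (Suc r))"
    by (simp add: n)
  have expo: "- ((int n - int d - int r) * (int n - int r)) = - int (Suc d)"
    by (simp add: n)
  have pos: "0 < q_pochhammer (q powi (- int r)) q r"
    using assms by (intro q_pochhammer_neg_power_pos) auto
  have q1: "q powi (- 1) < 1" using assms by (simp add: field_simps)
  have ratio: "q_pochhammer (q powi (- int (Suc r))) q r / q_pochhammer (q powi (- int r)) q r
      = (1 - q powi (- int (Suc r))) / (1 - q powi (- 1))"
    using q_pochhammer_neg_power_shift[OF assms(1), of r] pos q1 by (subst frac_eq_eq) auto
  have prefactor: "q powi (- int (Suc d)) / (1 - q powi (- 1)) = q powi (- int d) / (q - 1)"
  proof -
    have "q powi (- int (Suc d)) * q = q powi (- int d)"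
      using assms power_int_add_1[of q "- int (Suc d)"] by simp
    then show ?thesis using assms by (simp add: field_simps power_int_minus)
  qed
  have "P_mat q n d r = q powi (- int (Suc d)) *
      (q_pochhammer (q powi (- int (Suc r))) q r / q_pochhammer (q powi (- int r)) q r)
      * q_pochhammer (q powi (- int n)) q r"
    unfolding P_mat_def expo eq by (simp add: n)
  also have "\<dots> = q powi (- int (Suc d)) / (1 - q powi (- 1)) * (1 - q powi (- int (Suc r)))
      * q_pochhammer (q powi (- int n)) q r"
    unfolding ratio by simp
  finally have P: "P_mat q n d r = q powi (- int d) / (q - 1) * (1 - q powi (- int (Suc r)))
      * q_pochhammer (q powi (- int n)) q r"
    unfolding prefactor .
  have "1 - q powi (- int (Suc d)) / (q - 1) \<le> q_pochhammer (q powi (- int n)) q r"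
    using q_pochhammer_neg_power_ge[of q r n] assms by (simp add: n)
  moreover have "0 \<le> q powi (- int d) / (q - 1) * (1 - q powi (- int (Suc r)))"
    using assms by (intro mult_nonneg_nonneg) (auto intro!: powi_neg_le_1 simp del: of_nat_Suc)
  ultimately show ?thesis
    unfolding r_def[symmetric] P nd by (intro mult_left_mono)
qed

abbreviation two_step :: "real \<Rightarrow> nat \<Rightarrow> nat \<Rightarrow> nat \<Rightarrow> real" where
  "two_step q n \<equiv> kernel_pow (P_mat q n) {0..n} 2"

lemma two_step_ge:
  assumes "q > 1" "d \<le> n" "c \<le> n" "e \<le> n"
  shows "P_mat q n d c * P_mat q n c e \<le> two_step q n d e"
proof -
  have eq: "two_step q n d e = (\<Sum>z\<in>{0..n}. P_mat q n d z * P_mat q n z e)"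
    using assms by (simp add: eval_nat_numeral if_distrib[of "\<lambda>a. _ * a"] cong: if_cong)
  show ?thesis unfolding eq
    using assms P_mat_nonneg[OF assms(1)]
    by (intro member_le_sum[of c "{0..n}" "\<lambda>z. P_mat q n d z * P_mat q n z e"]) auto
qed

text \<open>
  The time that two steps of the discrete chain take on the time scale of \<open>Y_proc\<close>.
\<close>

definition step_length :: "real \<Rightarrow> nat \<Rightarrow> real" where
  "step_length q n = 1 / (q powr (real n / 2) * (q - 1))"

context
  fixes q :: real and n d :: nat and a :: real
  assumes q: "q \<ge> 2" and d: "real d = a + real n / 2"
begin

lemma powi_eq_step_length:
  assumes "real_of_int j = - real n / 2 + b"
  shows "q powi j / (q - 1) = step_length q n * q powr b"
proof -
  have "q powi j = q powr (- real n / 2 + b)"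
    using q assms powr_real_of_int'[of q j] by simp
  also have "\<dots> = q powr b / q powr (real n / 2)"
    by (simp add: powr_diff[symmetric] algebra_simps)
  finally show ?thesis by (simp add: step_length_def field_simps)
qed

lemma powi_div_le_1: "q powi (- int j) / (q - 1) \<le> 1"
proof -
  have "q powi (- int j) \<le> 1" using q by (intro powi_neg_le_1) auto
  then show ?thesis using q by (simp add: field_simps)
qed

text \<open>
  Two successive reflections return to \<open>d\<close>. A single application of \<open>(1 - u) (1 - v) \<ge> 1 - u - v\<close>
  yields the diagonal rate without any error term.
\<close>

lemma two_step_stay_ge:
  assumes "d \<le> n"
  shows "1 + step_length q n * (- (q powr a) - q powr (- a)) \<le> two_step q n d d"
proof -
  let ?u = "step_length q n * q powr (- a)" and ?v = "step_length q n * q powr a"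
  have u: "q powi (- int d) / (q - 1) = ?u" using d by (intro powi_eq_step_length) auto
  have v: "q powi (- int (n - d)) / (q - 1) = ?v"
    using d assms by (intro powi_eq_step_length) (auto simp: of_nat_diff)
  have "1 - ?u \<le> P_mat q n d (n - d)" "1 - ?v \<le> P_mat q n (n - d) d"
    using P_mat_reflect_ge[of q d n] P_mat_reflect_ge[of q "n - d" n] u v q assms by auto
  moreover have "?u \<le> 1" "?v \<le> 1" "0 \<le> ?u" "0 \<le> ?v"
    using powi_div_le_1[of d] powi_div_le_1[of "n - d"] q u v by (auto simp: step_length_def)
  ultimately have "(1 - ?u) * (1 - ?v) \<le> P_mat q n d (n - d) * P_mat q n (n - d) d"
    by (intro mult_mono) auto
  also have "\<dots> \<le> two_step q n d d" using q assms by (intro two_step_ge) auto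
  finally show ?thesis using mult_nonneg_nonneg[OF \<open>0 \<le> ?u\<close> \<open>0 \<le> ?v\<close>] by (simp add: algebra_simps)
qed

text \<open>
  A short first step followed by a reflection moves from \<open>d\<close> to \<open>d + 1\<close>.
\<close>

lemma two_step_up_ge:
  assumes "d < n"
  shows "step_length q n * (q powr (- a) * (1 - step_length q n * (q - 1) * q powr a)
      * (1 - step_length q n * q powr (- a - 1)) * (1 - step_length q n * q powr (a + 1)))
    \<le> two_step q n d (Suc d)"
proof -
  let ?h = "step_length q n"
  have u: "q powi (- int d) / (q - 1) = ?h * q powr (- a)"
    using d by (intro powi_eq_step_length) auto
  have v: "q powi (- int (n - d)) / (q - 1) = ?h * q powr a"
    using d assms by (intro powi_eq_step_length) (auto simp: of_nat_diff)
  have v': "q powi (- int (n - d)) = ?h * (q - 1) * q powr a"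
    using v q by (simp add: field_simps)
  have u1: "q powi (- int (Suc d)) / (q - 1) = ?h * q powr (- a - 1)"
    using d by (intro powi_eq_step_length) auto
  have v1: "q powi (- int (n - Suc d)) / (q - 1) = ?h * q powr (a + 1)"
    using d assms by (intro powi_eq_step_length) (auto simp: of_nat_diff)
  have le1: "?h * (q - 1) * q powr a \<le> 1" "?h * q powr (- a - 1) \<le> 1" "?h * q powr (a + 1) \<le> 1"
    unfolding v'[symmetric] u1[symmetric] v1[symmetric]
    using powi_div_le_1[of "Suc d"] powi_div_le_1[of "n - Suc d"] q
    by (auto intro!: powi_neg_le_1 simp del: of_nat_Suc)
  have "?h * q powr (- a) * (1 - ?h * (q - 1) * q powr a) * (1 - ?h * q powr (- a - 1))
      \<le> P_mat q n d (n - Suc d)"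
    using P_mat_defect_ge[of q d n] assms q unfolding u u1 v' by simp
  moreover have "1 - ?h * q powr (a + 1) \<le> P_mat q n (n - Suc d) (Suc d)"
    using P_mat_reflect_ge[of q "n - Suc d" n] assms q unfolding v1 by simp
  moreover have "0 \<le> ?h" using q by (simp add: step_length_def)
  ultimately have "?h * q powr (- a) * (1 - ?h * (q - 1) * q powr a) * (1 - ?h * q powr (- a - 1))
        * (1 - ?h * q powr (a + 1))
      \<le> P_mat q n d (n - Suc d) * P_mat q n (n - Suc d) (Suc d)"
    using le1 q by (intro mult_mono P_mat_nonneg) auto
  also have "\<dots> \<le> two_step q n d (Suc d)" using q assms by (intro two_step_ge) auto
  finally show ?thesis by (simp add: mult.assoc)
qed

text \<open>
  A reflection followed by a short step moves from \<open>d\<close> to \<open>d - 1\<close>.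
\<close>

lemma two_step_down_ge:
  assumes "0 < d" "d \<le> n"
  shows "step_length q n * (q powr a * (1 - step_length q n * (q - 1) * q powr (- a))
      * (1 - step_length q n * q powr (a - 1)) * (1 - step_length q n * q powr (- a)))
    \<le> two_step q n d (d - 1)"
proof -
  let ?h = "step_length q n"
  have u: "q powi (- int d) / (q - 1) = ?h * q powr (- a)"
    using d by (intro powi_eq_step_length) auto
  have v: "q powi (- int (n - d)) / (q - 1) = ?h * q powr a"
    using d assms by (intro powi_eq_step_length) (auto simp: of_nat_diff)
  have u': "q powi (- int d) = ?h * (q - 1) * q powr (- a)"
    using u q by (simp add: field_simps)
  have v1: "q powi (- int (Suc (n - d))) / (q - 1) = ?h * q powr (a - 1)"
    using d assms by (intro powi_eq_step_length) (auto simp: of_nat_diff)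
  have le1: "?h * (q - 1) * q powr (- a) \<le> 1" "?h * q powr (a - 1) \<le> 1" "?h * q powr (- a) \<le> 1"
    unfolding u'[symmetric] u[symmetric] v1[symmetric]
    using powi_div_le_1[of "Suc (n - d)"] powi_div_le_1[of d] q
    by (auto intro!: powi_neg_le_1 simp del: of_nat_Suc)
  have "?h * q powr a * (1 - ?h * (q - 1) * q powr (- a)) * (1 - ?h * q powr (a - 1))
      \<le> P_mat q n (n - d) (n - Suc (n - d))"
    using P_mat_defect_ge[of q "n - d" n] assms q unfolding v v1 by (simp add: u')
  moreover have "n - Suc (n - d) = d - 1" using assms by simp
  moreover have "1 - ?h * q powr (- a) \<le> P_mat q n d (n - d)"
    using P_mat_reflect_ge[of q d n] assms q unfolding u by simp
  moreover have "0 \<le> ?h" using q by (simp add: step_length_def)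
  ultimately have "?h * q powr a * (1 - ?h * (q - 1) * q powr (- a)) * (1 - ?h * q powr (a - 1))
        * (1 - ?h * q powr (- a))
      \<le> P_mat q n (n - d) (d - 1) * P_mat q n d (n - d)"
    using le1 q by (intro mult_mono P_mat_nonneg) auto
  also have "\<dots> \<le> two_step q n d (d - 1)"
    using q assms two_step_ge[of q d n "n - d" "d - 1"] by (simp add: mult.commute)
  finally show ?thesis by (simp add: mult.assoc)
qed

end

section \<open>Rates on the half-odd integers\<close>

lemma half_odd_pred_succ: "x \<in> half_odd_integers \<Longrightarrow> x - 1 \<in> half_odd_integers \<and> x + 1 \<in> half_odd_integers"
proof -
  assume "x \<in> half_odd_integers"
  then obtain i :: int where i: "x = of_int i + 1 / 2" by (auto simp: half_odd_integers_def)
  have "x - 1 = of_int (i - 1) + 1 / 2" "x + 1 = of_int (i + 1) + 1 / 2" by (auto simp: i)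
  then show ?thesis unfolding half_odd_integers_def by blast
qed

lemma finite_half_odd_le: "finite {x \<in> half_odd_integers. \<bar>x\<bar> \<le> R}"
proof (rule finite_subset)
  show "{x \<in> half_odd_integers. \<bar>x\<bar> \<le> R} \<subseteq> (\<lambda>i::int. of_int i + 1 / 2) ` {\<lfloor>- R\<rfloor> - 1..\<lceil>R\<rceil>}"
  proof
    fix x assume x: "x \<in> {x \<in> half_odd_integers. \<bar>x\<bar> \<le> R}"
    then obtain i :: int where i: "x = of_int i + 1 / 2" by (auto simp: half_odd_integers_def)
    have "i \<in> {\<lfloor>- R\<rfloor> - 1..\<lceil>R\<rceil>}"
      using x unfolding i by (auto simp: abs_le_iff) linarith+
    then show "x \<in> (\<lambda>i::int. of_int i + 1 / 2) ` {\<lfloor>- R\<rfloor> - 1..\<lceil>R\<rceil>}" using i by blast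
  qed
qed auto

text \<open>
  Away from \<open>\<plusminus>1/2\<close> the stronger of the two rates points towards 0, so the drift of \<open>\<bar>x\<bar>\<close> is
  nonpositive. At \<open>\<plusminus>1/2\<close> the inward jump leaves \<open>\<bar>x\<bar>\<close> unchanged and the outward one has rate
  \<open>q\<^sup>-\<^sup>1\<^sup>/\<^sup>2 \<le> 1\<close>.
\<close>

lemma Q_odd_drift:
  assumes "q \<ge> 1" "x \<in> half_odd_integers"
  shows "q powr (- x) * \<bar>x + 1\<bar> + q powr x * \<bar>x - 1\<bar> - (q powr x + q powr (- x)) * \<bar>x\<bar> \<le> 1"
proof -
  have *: "q powr (- y) \<le> q powr y" if "y \<ge> 0" for y
    using assms that by (intro powr_mono) auto
  have small: "q powr (- (1/2)) \<le> 1" using assms powr_mono[of "-(1/2)" 0 q] by simp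
  obtain i :: int where i: "x = of_int i + 1 / 2" using assms by (auto simp: half_odd_integers_def)
  consider "i \<ge> 1" | "i = 0" | "i = -1" | "i \<le> -2" by linarith
  then show ?thesis
  proof cases
    case 1
    then have "x \<ge> 1" using i by simp
    then show ?thesis using *[of x] by (simp add: algebra_simps)
  next
    case 4
    then have "real_of_int i \<le> -2" by simp
    then have "x \<le> -1" using i by simp
    then show ?thesis using *[of "-x"] by (simp add: algebra_simps)
  qed (use small in \<open>auto simp: i algebra_simps\<close>)
qed

lemma lyapunov_rates_Q_odd:
  assumes "q \<ge> 1"
  shows "lyapunov_rates half_odd_integers (Q_odd q) (\<lambda>x. {x - 1, x, x + 1}) abs 1"
proof
  fix x y :: real
  assume x: "x \<in> half_odd_integers"
  show "{x - 1, x, x + 1} \<subseteq> half_odd_integers"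
    using x half_odd_pred_succ by auto
  show "(\<Sum>y\<in>{x - 1, x, x + 1}. Q_odd q x y) = 0"
    by (simp add: Q_odd_def)
  show "(\<Sum>y\<in>{x - 1, x, x + 1}. Q_odd q x y * \<bar>y\<bar>) \<le> 1"
    using Q_odd_drift[OF assms x] by (simp add: Q_odd_def algebra_simps)
qed (auto simp: Q_odd_def finite_half_odd_le)

section \<open>Local comparison of the two-step chain with the rates\<close>

abbreviation along_odd :: "nat filter" where
  "along_odd \<equiv> inf sequentially (principal {n. odd n})"

text \<open>
  The state \<open>d\<close> of the discrete chain that corresponds to \<open>a = d - n/2\<close>; meaningful for odd \<open>n\<close>
  and \<open>\<bar>a\<bar> \<le> n/2\<close>.
\<close>

definition chain_state :: "nat \<Rightarrow> real \<Rightarrow> nat" where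
  "chain_state n a = nat \<lfloor>a + real n / 2\<rfloor>"

lemma real_chain_state:
  assumes "odd n" "a \<in> half_odd_integers" "\<bar>a\<bar> \<le> real n / 2"
  shows "real (chain_state n a) = a + real n / 2"
proof -
  obtain i :: int where i: "a = of_int i + 1 / 2" using assms by (auto simp: half_odd_integers_def)
  obtain l where l: "n = 2 * l + 1" using assms by (auto elim: oddE)
  have "a + real n / 2 = of_int (i + int l + 1)" by (simp add: i l add_divide_distrib)
  moreover have "0 \<le> a + real n / 2" using assms by linarith
  ultimately show ?thesis by (simp add: chain_state_def)
qed

lemma eventually_along_odd:
  assumes "finite B" "B \<subseteq> half_odd_integers"
  shows "\<forall>\<^sub>F n in along_odd. odd n \<and> (\<forall>a\<in>B. \<bar>a\<bar> < real n / 2)"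
proof -
  have "filterlim (\<lambda>n. real n / 2) at_top sequentially" by real_asymp
  then have "\<forall>\<^sub>F n in sequentially. \<forall>a\<in>B. \<bar>a\<bar> < real n / 2"
    using assms by (intro eventually_ball_finite ballI) (auto simp: filterlim_at_top_dense)
  then show ?thesis by (auto simp: eventually_inf_principal elim: eventually_mono)
qed

lemma step_length_tendsto:
  assumes "q > 1"
  shows "filterlim (step_length q) (at_right 0) along_odd"
proof -
  have "filterlim (step_length q) (at_right 0) sequentially"
    using assms unfolding step_length_def by real_asymp
  then show ?thesis by (rule filterlim_mono) auto
qed

text \<open>
  Once \<open>B\<close> embeds into \<open>{0..n}\<close>, restricting the intermediate states to the image of \<open>B\<close> drops
  nonnegative terms from the product of kernels.
\<close>

lemma eventually_superconvolutive_two_step: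
  assumes q: "q > 1" and B: "finite B" "B \<subseteq> half_odd_integers"
  shows "\<forall>\<^sub>F n in along_odd. superconvolutive B
    (\<lambda>j a b. kernel_pow (P_mat q n) {0..n} (2 * j) (chain_state n a) (chain_state n b))"
  using eventually_along_odd[OF B]
proof eventually_elim
  case (elim n)
  have r: "real (chain_state n a) = a + real n / 2" if "a \<in> B" for a
    using elim that B by (intro real_chain_state) (auto intro: less_imp_le)
  have inj: "inj_on (chain_state n) B"
    by (rule inj_onI) (metis r add_right_cancel)
  have sub: "chain_state n ` B \<subseteq> {0..n}"
  proof safe
    fix a assume a: "a \<in> B"
    have "real (chain_state n a) < real n" using r[OF a] elim a by (auto simp: abs_less_iff)
    then show "chain_state n a \<in> {0..n}" by simp
  qed
  let ?K = "kernel_pow (P_mat q n) {0..n}"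
  have nonneg: "0 \<le> ?K j x y" if "x \<le> n" for j x y
    using that by (intro kernel_pow_nonneg P_mat_nonneg q) auto
  have "(\<Sum>c\<in>B. ?K (2 * 1) (chain_state n a) (chain_state n c) * ?K (2 * j) (chain_state n c) (chain_state n b))
      \<le> ?K (2 * Suc j) (chain_state n a) (chain_state n b)" if "a \<in> B" "b \<in> B" for j a b
  proof -
    have "(\<Sum>c\<in>B. ?K (2 * 1) (chain_state n a) (chain_state n c) * ?K (2 * j) (chain_state n c) (chain_state n b))
        = (\<Sum>z\<in>chain_state n ` B. ?K (2 * 1) (chain_state n a) z * ?K (2 * j) z (chain_state n b))"
      by (subst sum.reindex[OF inj]) auto
    also have "\<dots> \<le> (\<Sum>z\<in>{0..n}. ?K (2 * 1) (chain_state n a) z * ?K (2 * j) z (chain_state n b))"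
      using sub that by (intro sum_mono2 mult_nonneg_nonneg nonneg) auto
    also have "\<dots> = ?K (2 * 1 + 2 * j) (chain_state n a) (chain_state n b)"
      using sub that by (intro kernel_pow_add[symmetric]) auto
    finally show ?thesis by simp
  qed
  then show ?case
    using nonneg sub unfolding superconvolutive_def by (auto simp del: kernel_pow.simps(2))
qed

text \<open>
  The local comparison of the two-step chain with the rates. The correction factors in the bounds for the
  jumps tend to 1 with the step length; at non-neighbouring pairs nonnegativity of the
  kernel suffices because the rate is 0.
\<close>

lemma eventually_two_step_ge:
  assumes q: "q \<ge> 2" and a: "a \<in> half_odd_integers" and b: "b \<in> half_odd_integers" and e: "0 < e"
  shows "\<forall>\<^sub>F n in along_odd. (if a = b then 1 else 0) + step_length q n * (Q_odd q a b - e)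
    \<le> two_step q n (chain_state n a) (chain_state n b)"
proof -
  have h: "filterlim (step_length q) (at_right 0) along_odd"
    using q by (intro step_length_tendsto) auto
  then have h0: "(step_length q \<longlongrightarrow> 0) along_odd" by (simp add: filterlim_at)
  have hpos: "0 \<le> step_length q n" for n using q by (simp add: step_length_def)
  have ev: "\<forall>\<^sub>F n in along_odd. odd n \<and> (\<forall>x\<in>{a, b}. \<bar>x\<bar> < real n / 2)"
    using a b by (intro eventually_along_odd) auto
  note r = real_chain_state[OF _ a] real_chain_state[OF _ b]
  have jump: "\<forall>\<^sub>F n in along_odd. step_length q n * (c - e) \<le> step_length q n *
      (c * (1 - step_length q n * c1) * (1 - step_length q n * c2) * (1 - step_length q n * c3))"
    for c c1 c2 c3
  proof -
    have "((\<lambda>n. c * (1 - step_length q n * c1) * (1 - step_length q n * c2) * (1 - step_length q n * c3))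
        \<longlongrightarrow> c * (1 - 0 * c1) * (1 - 0 * c2) * (1 - 0 * c3)) along_odd"
      by (intro tendsto_intros h0)
    then have "\<forall>\<^sub>F n in along_odd.
        c - e < c * (1 - step_length q n * c1) * (1 - step_length q n * c2) * (1 - step_length q n * c3)"
      using e by (intro order_tendstoD(1)) auto
    then show ?thesis
      by eventually_elim (auto intro!: mult_left_mono hpos)
  qed
  consider "b = a" | "b = a + 1" | "b = a - 1" | "b \<noteq> a" "b \<noteq> a + 1" "b \<noteq> a - 1" by blast
  then show ?thesis
  proof cases
    case 1
    show ?thesis using ev
    proof eventually_elim
      case (elim n)
      have ra: "real (chain_state n a) = a + real n / 2" using elim by (intro r) auto
      moreover have "real (chain_state n a) \<le> real n" using ra elim by (auto simp: abs_less_iff)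
      ultimately have "1 + step_length q n * (- (q powr a) - q powr (- a))
          \<le> two_step q n (chain_state n a) (chain_state n a)"
        using q by (intro two_step_stay_ge) auto
      moreover have "0 \<le> step_length q n * e" using hpos e by simp
      ultimately show ?case using 1 by (simp add: Q_odd_def right_diff_distrib)
    qed
  next
    case 2
    show ?thesis
      using ev jump[of "q powr (- a)" "(q - 1) * q powr a" "q powr (- a - 1)" "q powr (a + 1)"]
    proof eventually_elim
      case (elim n)
      have ra: "real (chain_state n a) = a + real n / 2" using elim by (intro r) auto
      have rb: "real (chain_state n b) = b + real n / 2" using elim by (intro r) auto
      have "real (chain_state n b) = real (Suc (chain_state n a))" using ra rb 2 by simp
      then have "chain_state n b = Suc (chain_state n a)" by linarith
      moreover have "real (chain_state n a) < real n" using ra elim by (auto simp: abs_less_iff)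
      ultimately show ?case
        using 2 elim(2) two_step_up_ge[OF q ra] by (simp add: Q_odd_def mult.assoc)
    qed
  next
    case 3
    show ?thesis
      using ev jump[of "q powr a" "(q - 1) * q powr (- a)" "q powr (a - 1)" "q powr (- a)"]
    proof eventually_elim
      case (elim n)
      have ra: "real (chain_state n a) = a + real n / 2" using elim by (intro r) auto
      have rb: "real (chain_state n b) = b + real n / 2" using elim by (intro r) auto
      have "real (chain_state n a) = real (Suc (chain_state n b))" using ra rb 3 by simp
      then have "chain_state n a = Suc (chain_state n b)" by linarith
      moreover have "real (chain_state n a) < real n" using ra elim by (auto simp: abs_less_iff)
      ultimately show ?case
        using 3 elim(2) two_step_down_ge[OF q ra] by (simp add: Q_odd_def mult.assoc)
    qed
  next
    case 4
    show ?thesis using ev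
    proof eventually_elim
      case (elim n)
      have ra: "real (chain_state n a) = a + real n / 2" using elim by (intro r) auto
      have "real (chain_state n a) < real n" using ra elim by (auto simp: abs_less_iff)
      then have "0 \<le> two_step q n (chain_state n a) (chain_state n b)"
        using q by (intro kernel_pow_nonneg P_mat_nonneg) auto
      moreover have "0 \<le> step_length q n * e" using hpos e by simp
      ultimately show ?case using 4 by (simp add: Q_odd_def)
    qed
  qed
qed

section \<open>Markov chains observed at finitely many times\<close>

lemma discrete_markov_path_step:
  assumes X: "discrete_markov_chain M S P X" and x: "\<And>i. i \<le> Suc m \<Longrightarrow> x i \<in> S"
  shows "measure M {\<omega> \<in> space M. \<forall>i\<le>Suc m. X i \<omega> = x i}
       = measure M {\<omega> \<in> space M. \<forall>i\<le>m. X i \<omega> = x i} * P (x m) (x (Suc m))"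
proof -
  interpret prob_space M using X by (simp add: discrete_markov_chain_def)
  have [measurable]: "X i \<in> measurable M (count_space S)" for i
    using X by (simp add: discrete_markov_chain_def)
  let ?A = "{\<omega> \<in> space M. \<forall>i\<le>m. X i \<omega> = x i}"
  have A: "?A \<in> sets M" by measurable
  have eq: "{\<omega> \<in> space M. \<forall>i\<le>Suc m. X i \<omega> = x i}
      = {\<omega> \<in> space M. X (Suc m) \<omega> = x (Suc m) \<and> (\<forall>i\<le>m. X i \<omega> = x i)}"
    by (auto simp: le_Suc_eq)
  show ?thesis
  proof (cases "measure M ?A > 0")
    case True
    then have "cond_prob M (\<lambda>\<omega>. X (Suc m) \<omega> = x (Suc m)) (\<lambda>\<omega>. \<forall>i\<le>m. X i \<omega> = x i)
        = P (x m) (x (Suc m))"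
      using X x unfolding discrete_markov_chain_def by blast
    then show ?thesis using True unfolding eq cond_prob_def by (simp add: field_simps)
  next
    case False
    \<comment> \<open>Conditioning on a null event says nothing, but both sides vanish.\<close>
    then have "measure M ?A = 0" by (simp add: zero_less_measure_iff)
    moreover have "measure M {\<omega> \<in> space M. \<forall>i\<le>Suc m. X i \<omega> = x i} \<le> measure M ?A"
      by (rule finite_measure_mono[OF _ A]) auto
    ultimately show ?thesis using measure_nonneg[of M] by (simp add: antisym)
  qed
qed

text \<open>
  Extends the Markov property from a single past trajectory to an event \<open>R\<close> of the past that fixes
  the present state, by splitting \<open>R\<close> into the finitely many trajectories in it.
\<close>

lemma discrete_markov_past_step:
  assumes X: "discrete_markov_chain M S P X" and S: "finite S"
    and dep: "\<And>f g. (\<And>i. i \<le> m \<Longrightarrow> f i = g i) \<Longrightarrow> R f = R g"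
    and R: "\<And>f. R f \<Longrightarrow> f m = x" and y: "y \<in> S"
  shows "measure M {\<omega> \<in> space M. R (\<lambda>i. X i \<omega>) \<and> X (Suc m) \<omega> = y}
       = measure M {\<omega> \<in> space M. R (\<lambda>i. X i \<omega>)} * P x y"
proof -
  interpret prob_space M using X by (simp add: discrete_markov_chain_def)
  have X_meas [measurable]: "X i \<in> measurable M (count_space S)" for i
    using X by (simp add: discrete_markov_chain_def)
  have X_in: "X i \<omega> \<in> S" if "\<omega> \<in> space M" for i \<omega>
    using measurable_space[OF X_meas that] by simp
  define T where "T = {f \<in> PiE {..m} (\<lambda>_. S). R f}"
  define E where "E f = {\<omega> \<in> space M. \<forall>i\<le>m. X i \<omega> = f i}" for f
  define E' where "E' f = {\<omega> \<in> space M. \<forall>i\<le>Suc m. X i \<omega> = (f(Suc m := y)) i}" for f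
  have finT: "finite T" unfolding T_def using S by (auto intro!: finite_subset[OF Collect_subset] finite_PiE simp: Collect_conj_eq)
  have E_meas: "E f \<in> sets M" "E' f \<in> sets M" for f
    unfolding E_def E'_def by measurable
  have E'_eq: "E' f = {\<omega> \<in> E f. X (Suc m) \<omega> = y}" for f
    by (auto simp: E_def E'_def le_Suc_eq)
  have disj: "disjoint_family_on E T"
  proof -
    have "f = g" if "f \<in> T" "g \<in> T" "\<omega> \<in> E f" "\<omega> \<in> E g" for f g \<omega>
      using that unfolding T_def E_def by (intro PiE_ext[of f "{..m}" "\<lambda>_. S" g]) auto
    then show ?thesis unfolding disjoint_family_on_def by blast
  qed
  then have disj': "disjoint_family_on E' T"
    unfolding E'_eq disjoint_family_on_def by blast
  have un: "{\<omega> \<in> space M. R (\<lambda>i. X i \<omega>)} = (\<Union>f\<in>T. E f)"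
  proof safe
    fix \<omega> assume w: "\<omega> \<in> space M" "R (\<lambda>i. X i \<omega>)"
    have "R (\<lambda>i\<in>{..m}. X i \<omega>)" using w(2) by (subst dep[of _ "\<lambda>i. X i \<omega>"]) auto
    then have "(\<lambda>i\<in>{..m}. X i \<omega>) \<in> T" using X_in w(1) by (auto simp: T_def)
    then show "\<omega> \<in> (\<Union>f\<in>T. E f)"
      by (rule UN_I) (use w(1) in \<open>auto simp: E_def\<close>)
  next
    fix \<omega> f assume "f \<in> T" "\<omega> \<in> E f"
    then show "R (\<lambda>i. X i \<omega>)"
      by (subst dep[of _ f]) (auto simp: T_def E_def)
  qed (auto simp: E_def)
  have un': "{\<omega> \<in> space M. R (\<lambda>i. X i \<omega>) \<and> X (Suc m) \<omega> = y} = (\<Union>f\<in>T. E' f)"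
    using un unfolding E'_eq by blast
  have "measure M (E' f) = measure M (E f) * P x y" if "f \<in> T" for f
  proof -
    have "f i \<in> S" if "i \<le> m" for i using \<open>f \<in> T\<close> that by (auto simp: T_def)
    then have "measure M (E' f)
        = measure M {\<omega> \<in> space M. \<forall>i\<le>m. X i \<omega> = (f(Suc m := y)) i} * P (f m) y"
      unfolding E'_def using y
      by (subst discrete_markov_path_step[OF X]) (auto simp: le_Suc_eq)
    also have "{\<omega> \<in> space M. \<forall>i\<le>m. X i \<omega> = (f(Suc m := y)) i} = E f"
      by (auto simp: E_def)
    also have "f m = x" using R \<open>f \<in> T\<close> by (auto simp: T_def)
    finally show ?thesis .
  qed
  then have "(\<Sum>f\<in>T. measure M (E' f)) = (\<Sum>f\<in>T. measure M (E f)) * P x y"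
    by (simp add: sum_distrib_right)
  then show ?thesis
    unfolding un un' using E_meas
    by (simp add: finite_measure_finite_Union finT disj disj' image_subset_iff)
qed

text \<open>
  Here the present time \<open>m\<close> and the time of observation are \<open>j\<close> steps apart; \<open>R\<close> together with the
  state at time \<open>m + j\<close> is again an event of the past, which drives the induction on \<open>j\<close>.
\<close>

lemma discrete_markov_past_steps:
  assumes X: "discrete_markov_chain M S P X" and S: "finite S"
    and dep: "\<And>f g. (\<And>i. i \<le> m \<Longrightarrow> f i = g i) \<Longrightarrow> R f = R g"
    and R: "\<And>f. R f \<Longrightarrow> f m = x" and x: "x \<in> S" and y: "y \<in> S"
    and meas: "{\<omega> \<in> space M. R (\<lambda>i. X i \<omega>)} \<in> sets M"
  shows "measure M {\<omega> \<in> space M. R (\<lambda>i. X i \<omega>) \<and> X (m + j) \<omega> = y}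
       = measure M {\<omega> \<in> space M. R (\<lambda>i. X i \<omega>)} * kernel_pow P S j x y"
  using y
proof (induction j arbitrary: y)
  case 0
  have "{\<omega> \<in> space M. R (\<lambda>i. X i \<omega>) \<and> X (m + 0) \<omega> = y}
      = (if x = y then {\<omega> \<in> space M. R (\<lambda>i. X i \<omega>)} else {})"
    using R[of "\<lambda>i. X i _"] by auto
  then show ?case by simp
next
  case (Suc j)
  interpret prob_space M using X by (simp add: discrete_markov_chain_def)
  have X_meas [measurable]: "X i \<in> measurable M (count_space S)" for i
    using X by (simp add: discrete_markov_chain_def)
  have X_in: "X i \<omega> \<in> S" if "\<omega> \<in> space M" for i \<omega>
    using measurable_space[OF X_meas that] by simp
  define E where "E z = {\<omega> \<in> {\<omega> \<in> space M. R (\<lambda>i. X i \<omega>)}. X (m + j) \<omega> = z \<and> X (m + Suc j) \<omega> = y}" for z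
  have E_sets: "E z \<in> sets M" for z
  proof -
    have "E z = {\<omega> \<in> space M. R (\<lambda>i. X i \<omega>)}
        \<inter> {\<omega> \<in> space M. X (m + j) \<omega> = z \<and> X (m + Suc j) \<omega> = y}"
      by (auto simp: E_def)
    also have "\<dots> \<in> sets M"
      by (rule sets.Int[OF meas]) measurable
    finally show ?thesis .
  qed
  have "{\<omega> \<in> space M. R (\<lambda>i. X i \<omega>) \<and> X (m + Suc j) \<omega> = y} = (\<Union>z\<in>S. E z)"
    using X_in by (auto simp: E_def)
  also have "measure M \<dots> = (\<Sum>z\<in>S. measure M (E z))"
    using S E_sets by (intro finite_measure_finite_Union) (auto simp: disjoint_family_on_def E_def)
  also have "\<dots> = (\<Sum>z\<in>S. measure M {\<omega> \<in> space M. R (\<lambda>i. X i \<omega>) \<and> X (m + j) \<omega> = z} * P z y)"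
  proof (intro sum.cong refl)
    fix z assume z: "z \<in> S"
    have "measure M {\<omega> \<in> space M. (R (\<lambda>i. X i \<omega>) \<and> X (m + j) \<omega> = z) \<and> X (Suc (m + j)) \<omega> = y}
        = measure M {\<omega> \<in> space M. R (\<lambda>i. X i \<omega>) \<and> X (m + j) \<omega> = z} * P z y"
    proof (rule discrete_markov_past_step[OF X S, where R = "\<lambda>f. R f \<and> f (m + j) = z"])
      fix f g :: "nat \<Rightarrow> 'b" assume "\<And>i. i \<le> m + j \<Longrightarrow> f i = g i"
      then show "(R f \<and> f (m + j) = z) = (R g \<and> g (m + j) = z)"
        using dep[of f g] by auto
    qed (use Suc.prems in auto)
    moreover have "E z = {\<omega> \<in> space M. (R (\<lambda>i. X i \<omega>) \<and> X (m + j) \<omega> = z) \<and> X (Suc (m + j)) \<omega> = y}"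
      by (auto simp: E_def)
    ultimately show "measure M (E z)
        = measure M {\<omega> \<in> space M. R (\<lambda>i. X i \<omega>) \<and> X (m + j) \<omega> = z} * P z y" by simp
  qed
  also have "\<dots> = measure M {\<omega> \<in> space M. R (\<lambda>i. X i \<omega>)} * (\<Sum>z\<in>S. kernel_pow P S j x z * P z y)"
    using Suc.IH by (simp add: sum_distrib_left mult.assoc)
  also have "(\<Sum>z\<in>S. kernel_pow P S j x z * P z y) = (\<Sum>z\<in>S. kernel_pow P S j x z * kernel_pow P S 1 z y)"
    using S Suc.prems by (simp add: if_distrib[of "\<lambda>a. _ * a"] cong: if_cong)
  also have "\<dots> = kernel_pow P S (j + 1) x y"
    using S x by (rule kernel_pow_add[symmetric])
  finally show ?case by simp
qed

lemma discrete_markov_sampled_law: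
  assumes X: "discrete_markov_chain M S P X" and S: "finite S"
    and tau: "\<And>i. i < k \<Longrightarrow> \<tau> i \<le> \<tau> (Suc i)" and x: "\<And>i. i \<le> k \<Longrightarrow> x i \<in> S"
  shows "measure M {\<omega> \<in> space M. \<forall>i\<le>k. X (\<tau> i) \<omega> = x i}
       = measure M {\<omega> \<in> space M. X (\<tau> 0) \<omega> = x 0}
         * (\<Prod>i<k. kernel_pow P S (\<tau> (Suc i) - \<tau> i) (x i) (x (Suc i)))"
  using tau x
proof (induction k)
  case (Suc k)
  have [measurable]: "X i \<in> measurable M (count_space S)" for i
    using X by (simp add: discrete_markov_chain_def)
  have mono: "\<tau> i \<le> \<tau> k" if "i \<le> k" for i
    using that Suc.prems(1)
  proof (induction rule: inc_induct)
    case (step i)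
    then show ?case using order_trans[OF step.prems(1)[of i]] by simp
  qed simp
  have "measure M {\<omega> \<in> space M. (\<forall>i\<le>k. X (\<tau> i) \<omega> = x i) \<and> X (\<tau> k + (\<tau> (Suc k) - \<tau> k)) \<omega> = x (Suc k)}
      = measure M {\<omega> \<in> space M. \<forall>i\<le>k. X (\<tau> i) \<omega> = x i}
        * kernel_pow P S (\<tau> (Suc k) - \<tau> k) (x k) (x (Suc k))"
  proof (rule discrete_markov_past_steps[OF X S, where R = "\<lambda>f. \<forall>i\<le>k. f (\<tau> i) = x i"])
    show "{\<omega> \<in> space M. \<forall>i\<le>k. X (\<tau> i) \<omega> = x i} \<in> sets M" by measurable
    show "(\<forall>i\<le>k. f (\<tau> i) = x i) = (\<forall>i\<le>k. g (\<tau> i) = x i)"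
      if "\<And>i. i \<le> \<tau> k \<Longrightarrow> f i = g i" for f g :: "nat \<Rightarrow> 'b"
      using that mono by auto
  qed (use Suc.prems in auto)
  moreover have "\<tau> k + (\<tau> (Suc k) - \<tau> k) = \<tau> (Suc k)" using Suc.prems(1) by simp
  moreover have "{\<omega> \<in> space M. \<forall>i\<le>Suc k. X (\<tau> i) \<omega> = x i}
      = {\<omega> \<in> space M. (\<forall>i\<le>k. X (\<tau> i) \<omega> = x i) \<and> X (\<tau> (Suc k)) \<omega> = x (Suc k)}"
    by (auto simp: le_Suc_eq)
  moreover note Suc.IH
  ultimately show ?case using Suc.prems by simp
qed simp

text \<open>
  The same iteration of the Markov property in continuous time, where the observation times may be
  chosen freely and no intermediate states have to be summed over.
\<close>

lemma continuous_markov_fdd: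
  assumes Z: "continuous_markov_chain N S Q Z"
  shows "\<exists>p. transition_function S p \<and> has_rates S p Q \<and>
    (\<forall>k s x. 0 \<le> s 0 \<and> strict_mono_on {..k} s \<and> (\<forall>i\<le>k. x i \<in> S) \<longrightarrow>
       measure N {\<omega> \<in> space N. \<forall>i\<le>k. Z (s i) \<omega> = x i}
       = measure N {\<omega> \<in> space N. Z (s 0) \<omega> = x 0} * (\<Prod>i<k. p (s (Suc i) - s i) (x i) (x (Suc i))))"
proof -
  interpret prob_space N using Z by (simp add: continuous_markov_chain_def)
  have Z_meas: "Z t \<in> measurable N (count_space S)" if "t \<ge> 0" for t
    using Z that by (simp add: continuous_markov_chain_def)
  obtain p where p: "transition_function S p" "has_rates S p Q"
    and "\<forall>m s x. 0 \<le> s 0 \<and> strict_mono_on {..Suc m} s \<and> (\<forall>i\<le>Suc m. x i \<in> S) \<and>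
       measure N {\<omega> \<in> space N. \<forall>i\<le>m. Z (s i) \<omega> = x i} > 0 \<longrightarrow>
       cond_prob N (\<lambda>\<omega>. Z (s (Suc m)) \<omega> = x (Suc m)) (\<lambda>\<omega>. \<forall>i\<le>m. Z (s i) \<omega> = x i)
         = p (s (Suc m) - s m) (x m) (x (Suc m))"
    using Z unfolding continuous_markov_chain_def by (elim conjE exE)
  then have markov: "cond_prob N (\<lambda>\<omega>. Z (s (Suc m)) \<omega> = x (Suc m)) (\<lambda>\<omega>. \<forall>i\<le>m. Z (s i) \<omega> = x i)
         = p (s (Suc m) - s m) (x m) (x (Suc m))"
    if "0 \<le> s 0" "strict_mono_on {..Suc m} s" "\<And>i. i \<le> Suc m \<Longrightarrow> x i \<in> S"
       "measure N {\<omega> \<in> space N. \<forall>i\<le>m. Z (s i) \<omega> = x i} > 0" for m s x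
    using that by auto
  have "measure N {\<omega> \<in> space N. \<forall>i\<le>k. Z (s i) \<omega> = x i}
       = measure N {\<omega> \<in> space N. Z (s 0) \<omega> = x 0} * (\<Prod>i<k. p (s (Suc i) - s i) (x i) (x (Suc i)))"
    if "0 \<le> s 0" "strict_mono_on {..k} s" "\<And>i. i \<le> k \<Longrightarrow> x i \<in> S" for k s x
    using that
  proof (induction k)
    case (Suc k)
    let ?A = "{\<omega> \<in> space N. \<forall>i\<le>k. Z (s i) \<omega> = x i}"
    have mono: "strict_mono_on {..k} s"
      by (rule monotone_on_subset[OF Suc.prems(2)]) auto
    have IH: "measure N ?A
        = measure N {\<omega> \<in> space N. Z (s 0) \<omega> = x 0} * (\<Prod>i<k. p (s (Suc i) - s i) (x i) (x (Suc i)))"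
      using Suc.prems mono by (intro Suc.IH) auto
    have s_nonneg: "0 \<le> s i" if "i \<le> k" for i
      using strict_mono_onD[OF mono, of 0 i] that Suc.prems(1) by (cases "i = 0") auto
    have A: "?A \<in> sets N"
    proof -
      have "?A = {\<omega> \<in> space N. \<forall>i\<in>{..k}. Z (s i) \<omega> = x i}" by auto
      also have "\<dots> \<in> sets N"
      proof (rule sets.sets_Collect_finite_All)
        fix i assume "i \<in> {..k}"
        then have [measurable]: "Z (s i) \<in> measurable N (count_space S)"
          by (auto intro!: Z_meas s_nonneg)
        show "{\<omega> \<in> space N. Z (s i) \<omega> = x i} \<in> sets N" by measurable
      qed simp
      finally show ?thesis .
    qed
    have eq: "{\<omega> \<in> space N. \<forall>i\<le>Suc k. Z (s i) \<omega> = x i}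
        = {\<omega> \<in> space N. Z (s (Suc k)) \<omega> = x (Suc k) \<and> (\<forall>i\<le>k. Z (s i) \<omega> = x i)}"
      by (auto simp: le_Suc_eq)
    have "measure N {\<omega> \<in> space N. \<forall>i\<le>Suc k. Z (s i) \<omega> = x i}
        = measure N ?A * p (s (Suc k) - s k) (x k) (x (Suc k))"
    proof (cases "measure N ?A > 0")
      case True
      then show ?thesis
        using markov[OF Suc.prems True] unfolding eq cond_prob_def by (simp add: field_simps)
    next
      case False
      then have "measure N ?A = 0" by (simp add: zero_less_measure_iff)
      moreover have "measure N {\<omega> \<in> space N. \<forall>i\<le>Suc k. Z (s i) \<omega> = x i} \<le> measure N ?A"
        by (rule finite_measure_mono[OF _ A]) auto
      ultimately show ?thesis using measure_nonneg[of N] by (simp add: antisym)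
    qed
    then show ?case unfolding IH by simp
  qed simp
  then show ?thesis using p by (intro exI[of _ p] conjI allI impI) auto
qed

section \<open>Total variation distance and point masses\<close>

text \<open>
  Up to a small mass, \<open>\<nu>\<close> lives on a finite set of atoms, on which \<open>\<mu> n\<close> is nearly at least as
  large. Hence \<open>\<nu> A - e / 2 \<le> \<mu> n A\<close> for all \<open>A\<close> at once, and the reverse bound is the same statement
  for the complement of \<open>A\<close>, both measures having mass 1.
\<close>

lemma tv_dist_tendsto_0:
  assumes \<mu>: "\<forall>\<^sub>F n in F. prob_space (\<mu> n) \<and> sets (\<mu> n) = sets \<nu>" and \<nu>: "prob_space \<nu>"
    and T: "countable T" "measure \<nu> T = 1" "\<And>y. y \<in> T \<Longrightarrow> {y} \<in> sets \<nu>"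
    and liminf: "\<And>y e. y \<in> T \<Longrightarrow> 0 < e \<Longrightarrow> \<forall>\<^sub>F n in F. measure \<nu> {y} - e \<le> measure (\<mu> n) {y}"
  shows "((\<lambda>n. tv_dist (\<mu> n) \<nu>) \<longlongrightarrow> 0) F"
proof (rule tendstoI)
  fix e :: real assume e: "0 < e"
  interpret \<nu>: prob_space \<nu> by fact
  have T_ne: "T \<noteq> {}" using T(2) by auto
  define D where "D j = from_nat_into T ` {..<j}" for j :: nat
  have D_sub: "D j \<subseteq> T" for j using from_nat_into[OF T_ne] by (auto simp: D_def)
  have fin_sets: "B \<in> sets \<nu>" if "finite B" "B \<subseteq> T" for B
    using that by (induction rule: finite_induct) (auto intro: sets.insert_in_sets T(3))
  have "(\<lambda>j. measure \<nu> (D j)) \<longlonglongrightarrow> measure \<nu> (\<Union>j. D j)"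
  proof (rule \<nu>.finite_Lim_measure_incseq)
    show "range D \<subseteq> sets \<nu>" using D_sub by (auto intro!: fin_sets simp: D_def)
    show "incseq D" by (auto simp: incseq_def D_def)
  qed
  also have "(\<Union>j. D j) = T"
  proof -
    have "(\<Union>j. D j) = range (from_nat_into T)" by (auto simp: D_def)
    then show ?thesis using range_from_nat_into[OF T_ne T(1)] by simp
  qed
  finally have "\<forall>\<^sub>F j in sequentially. 1 - e / 4 < measure \<nu> (D j)"
    unfolding T(2) using e by (intro order_tendstoD(1)) auto
  then obtain j where j: "1 - e / 4 < measure \<nu> (D j)"
    by (auto simp: eventually_sequentially)
  define c where "c = e / (4 * (1 + real (card (D j))))"
  have c: "0 < c" "real (card (D j)) * c \<le> e / 4"
    using e by (auto simp: c_def field_simps add_pos_nonneg)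
  have "\<forall>\<^sub>F n in F. \<forall>y\<in>D j. measure \<nu> {y} - c \<le> measure (\<mu> n) {y}"
    using D_sub c by (intro eventually_ball_finite ballI liminf) (auto simp: D_def)
  with \<mu> show "\<forall>\<^sub>F n in F. dist (tv_dist (\<mu> n) \<nu>) 0 < e"
  proof eventually_elim
    case (elim n)
    interpret \<mu>: prob_space "\<mu> n" using elim by simp
    have sets_eq: "sets (\<mu> n) = sets \<nu>" using elim by simp
    have lower: "measure \<nu> A - e / 2 \<le> measure (\<mu> n) A" if A: "A \<in> sets \<nu>" for A
    proof -
      have fin: "finite (A \<inter> D j)" "A \<inter> D j \<subseteq> T" using D_sub by (auto simp: D_def)
      have Dj: "D j \<in> sets \<nu>" using D_sub by (intro fin_sets) (auto simp: D_def)
      have "measure \<nu> A \<le> measure \<nu> (A \<inter> D j) + measure \<nu> (space \<nu> - D j)"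
      proof -
        have "measure \<nu> A - measure \<nu> (A \<inter> D j) = measure \<nu> (A - D j)"
          using A Dj by (rule \<nu>.finite_measure_Diff'[symmetric])
        also have "\<dots> \<le> measure \<nu> (space \<nu> - D j)"
          using A Dj sets.sets_into_space[OF A] by (intro \<nu>.finite_measure_mono) auto
        finally show ?thesis by simp
      qed
      moreover have "measure \<nu> (space \<nu> - D j) \<le> e / 4"
        using j \<nu>.prob_compl[OF Dj] by simp
      moreover have "measure \<nu> (A \<inter> D j) - e / 4 \<le> measure (\<mu> n) (A \<inter> D j)"
      proof -
        have "measure \<nu> (A \<inter> D j) = (\<Sum>y\<in>A \<inter> D j. measure \<nu> {y})"
          using fin T(3) by (intro \<nu>.finite_measure_eq_sum_singleton) auto
        also have "\<dots> \<le> (\<Sum>y\<in>A \<inter> D j. measure (\<mu> n) {y} + c)"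
          using elim by (intro sum_mono) (auto simp: algebra_simps)
        also have "\<dots> = measure (\<mu> n) (A \<inter> D j) + real (card (A \<inter> D j)) * c"
          using fin T(3) sets_eq
          by (subst \<mu>.finite_measure_eq_sum_singleton[of "A \<inter> D j"]) (auto simp: sum.distrib)
        also have "real (card (A \<inter> D j)) * c \<le> real (card (D j)) * c"
          using c by (intro mult_right_mono) (auto intro!: card_mono simp: D_def)
        finally show ?thesis using c(2) by simp
      qed
      moreover have "measure (\<mu> n) (A \<inter> D j) \<le> measure (\<mu> n) A"
        using A sets_eq by (intro \<mu>.finite_measure_mono) auto
      ultimately show ?thesis by linarith
    qed
    have bound: "\<bar>measure (\<mu> n) A - measure \<nu> A\<bar> \<le> e / 2" if A: "A \<in> sets (\<mu> n)" for A
    proof -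
      have A': "A \<in> sets \<nu>" using A sets_eq by simp
      have "space (\<mu> n) = space \<nu>" using sets_eq by (rule sets_eq_imp_space_eq)
      then have "measure (\<mu> n) (space \<nu> - A) = 1 - measure (\<mu> n) A" using \<mu>.prob_compl[OF A] by simp
      moreover have "measure \<nu> (space \<nu> - A) = 1 - measure \<nu> A" using A' by (rule \<nu>.prob_compl)
      moreover have "measure \<nu> A - e / 2 \<le> measure (\<mu> n) A" using A' by (rule lower)
      moreover have "measure \<nu> (space \<nu> - A) - e / 2 \<le> measure (\<mu> n) (space \<nu> - A)"
        using A' by (intro lower) auto
      ultimately show ?thesis by linarith
    qed
    have "tv_dist (\<mu> n) \<nu> \<le> e / 2"
      unfolding tv_dist_def using bound by (intro cSUP_least) (auto intro: sets.empty_sets)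
    moreover have "0 \<le> tv_dist (\<mu> n) \<nu>"
    proof -
      have "bdd_above ((\<lambda>A. \<bar>measure (\<mu> n) A - measure \<nu> A\<bar>) ` sets (\<mu> n))"
        using bound by (intro bdd_aboveI2)
      then have "\<bar>measure (\<mu> n) {} - measure \<nu> {}\<bar> \<le> tv_dist (\<mu> n) \<nu>"
        unfolding tv_dist_def by (intro cSUP_upper) auto
      then show ?thesis by simp
    qed
    ultimately show ?case using e by simp
  qed
qed

text \<open>
  The factors \<open>a n i\<close> need not converge, but their minima with \<open>p i\<close> do.
\<close>

lemma eventually_prod_ge:
  fixes p :: "'i \<Rightarrow> real" and a :: "'n \<Rightarrow> 'i \<Rightarrow> real"
  assumes I: "finite I" and p: "\<And>i. i \<in> I \<Longrightarrow> 0 \<le> p i" and a: "\<forall>\<^sub>F n in F. \<forall>i\<in>I. 0 \<le> a n i"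
    and lim: "\<And>i e. i \<in> I \<Longrightarrow> 0 < e \<Longrightarrow> \<forall>\<^sub>F n in F. p i - e \<le> a n i" and e: "0 < e"
  shows "\<forall>\<^sub>F n in F. (\<Prod>i\<in>I. p i) - e \<le> (\<Prod>i\<in>I. a n i)"
proof -
  have "((\<lambda>n. min (a n i) (p i)) \<longlongrightarrow> p i) F" if "i \<in> I" for i
  proof (rule order_tendstoI)
    fix c assume "c < p i"
    then have "\<forall>\<^sub>F n in F. p i - (p i - c) / 2 \<le> a n i" using that by (intro lim) auto
    then show "\<forall>\<^sub>F n in F. c < min (a n i) (p i)"
      by eventually_elim (use \<open>c < p i\<close> in \<open>auto simp: field_simps\<close>)
  qed (auto simp: min_less_iff_disj)
  then have "((\<lambda>n. \<Prod>i\<in>I. min (a n i) (p i)) \<longlongrightarrow> (\<Prod>i\<in>I. p i)) F"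
    by (rule tendsto_prod)
  then have "\<forall>\<^sub>F n in F. (\<Prod>i\<in>I. p i) - e < (\<Prod>i\<in>I. min (a n i) (p i))"
    using e by (intro order_tendstoD(1)) auto
  then show ?thesis using a
  proof eventually_elim
    case (elim n)
    have "(\<Prod>i\<in>I. min (a n i) (p i)) \<le> (\<Prod>i\<in>I. a n i)"
      using elim p by (intro prod_mono) auto
    then show ?case using elim by simp
  qed
qed

lemma
  assumes M: "prob_space M" and W: "\<And>i. i \<in> {1..k} \<Longrightarrow> W (t i) \<in> borel_measurable M"
  shows prob_space_fdd: "prob_space (fdd M W k t)"
    and measure_fdd_singleton: "y \<in> PiE {1..k} (\<lambda>_. UNIV) \<Longrightarrow>
      measure (fdd M W k t) {y} = measure M {\<omega> \<in> space M. \<forall>i\<in>{1..k}. W (t i) \<omega> = y i}"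
    and measure_fdd_PiE: "(\<And>i. i \<in> {1..k} \<Longrightarrow> A i \<in> sets borel) \<Longrightarrow>
      measure (fdd M W k t) (PiE {1..k} A) = measure M {\<omega> \<in> space M. \<forall>i\<in>{1..k}. W (t i) \<omega> \<in> A i}"
proof -
  have meas: "(\<lambda>\<omega>. \<lambda>i\<in>{1..k}. W (t i) \<omega>) \<in> measurable M (\<Pi>\<^sub>M i\<in>{1..k}. borel)"
    using W by (rule measurable_restrict)
  show "prob_space (fdd M W k t)"
    unfolding fdd_def using M meas by (rule prob_space.prob_space_distr)
  have PiE: "measure (fdd M W k t) (PiE {1..k} A) = measure M {\<omega> \<in> space M. \<forall>i\<in>{1..k}. W (t i) \<omega> \<in> A i}"
    if "\<And>i. i \<in> {1..k} \<Longrightarrow> A i \<in> sets borel" for A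
  proof -
    have "PiE {1..k} A \<in> sets (\<Pi>\<^sub>M i\<in>{1..k}. borel)"
      using that by (intro sets_PiM_I_finite) auto
    then have "measure (fdd M W k t) (PiE {1..k} A)
        = measure M ((\<lambda>\<omega>. \<lambda>i\<in>{1..k}. W (t i) \<omega>) -` PiE {1..k} A \<inter> space M)"
      unfolding fdd_def by (rule measure_distr[OF meas])
    also have "(\<lambda>\<omega>. \<lambda>i\<in>{1..k}. W (t i) \<omega>) -` PiE {1..k} A \<inter> space M
        = {\<omega> \<in> space M. \<forall>i\<in>{1..k}. W (t i) \<omega> \<in> A i}"
      by (auto simp: PiE_iff)
    finally show ?thesis .
  qed
  show "measure (fdd M W k t) (PiE {1..k} A) = measure M {\<omega> \<in> space M. \<forall>i\<in>{1..k}. W (t i) \<omega> \<in> A i}"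
    if "\<And>i. i \<in> {1..k} \<Longrightarrow> A i \<in> sets borel"
    using that by (rule PiE)
  assume y: "y \<in> PiE {1..k} (\<lambda>_. UNIV)"
  then have "{y} = PiE {1..k} (\<lambda>i. {y i})" using PiE_singleton[of y "{1..k}"] by (simp add: PiE_iff)
  then show "measure (fdd M W k t) {y} = measure M {\<omega> \<in> space M. \<forall>i\<in>{1..k}. W (t i) \<omega> = y i}"
    using PiE[of "\<lambda>i. {y i}"] by simp
qed

lemma sets_fdd: "sets (fdd M W k t) = sets (\<Pi>\<^sub>M i\<in>{1..k}. borel)"
  by (simp add: fdd_def)

lemma singleton_in_sets_PiM_borel:
  assumes "y \<in> PiE {1..k::nat} (\<lambda>_. UNIV :: real set)"
  shows "{y} \<in> sets (\<Pi>\<^sub>M i\<in>{1..k}. borel)"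
proof -
  have "{y} = PiE {1..k} (\<lambda>i. {y i})" using assms PiE_singleton[of y "{1..k}"] by (simp add: PiE_iff)
  moreover have "PiE {1..k} (\<lambda>i. {y i}) \<in> sets (\<Pi>\<^sub>M i\<in>{1..k}. borel)"
    by (rule sets_PiM_I_finite) auto
  ultimately show ?thesis by simp
qed

section \<open>Convergence of the finite-dimensional laws\<close>

lemma floor_steps_tendsto:
  assumes q: "q > 1" and s: "0 \<le> s"
  shows "((\<lambda>n. real (nat \<lfloor>q powr (real n / 2) * (q - 1) * s\<rfloor>) * step_length q n) \<longlongrightarrow> s) along_odd"
proof (rule tendsto_sandwich)
  have h: "(step_length q \<longlongrightarrow> 0) along_odd"
    using step_length_tendsto[OF q] by (simp add: filterlim_at)
  show "((\<lambda>n. s - step_length q n) \<longlongrightarrow> s) along_odd"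
    using tendsto_diff[OF tendsto_const h, of s] by simp
  have h_pos: "0 < step_length q n" for n using q by (simp add: step_length_def)
  have cancel: "q powr (real n / 2) * (q - 1) * s * step_length q n = s" for n
    using q by (simp add: step_length_def)
  have nat_floor: "x - 1 \<le> real (nat \<lfloor>x\<rfloor>) \<and> real (nat \<lfloor>x\<rfloor>) \<le> x" if "0 \<le> x" for x :: real
    using that by linarith
  have "(q powr (real n / 2) * (q - 1) * s - 1) * step_length q n
      \<le> real (nat \<lfloor>q powr (real n / 2) * (q - 1) * s\<rfloor>) * step_length q n" for n
    using nat_floor[of "q powr (real n / 2) * (q - 1) * s"] q s h_pos[of n]
    by (intro mult_right_mono) auto
  then show "\<forall>\<^sub>F n in along_odd. s - step_length q n
      \<le> real (nat \<lfloor>q powr (real n / 2) * (q - 1) * s\<rfloor>) * step_length q n"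
    by (simp add: left_diff_distrib cancel)
  have "real (nat \<lfloor>q powr (real n / 2) * (q - 1) * s\<rfloor>) * step_length q n
      \<le> q powr (real n / 2) * (q - 1) * s * step_length q n" for n
    using nat_floor[of "q powr (real n / 2) * (q - 1) * s"] q s h_pos[of n]
    by (intro mult_right_mono) auto
  then show "\<forall>\<^sub>F n in along_odd. real (nat \<lfloor>q powr (real n / 2) * (q - 1) * s\<rfloor>) * step_length q n \<le> s"
    by (simp add: cancel)
qed simp

lemma Y_proc_eq_iff:
  assumes "odd n" "a \<in> half_odd_integers" "\<bar>a\<bar> \<le> real n / 2"
  shows "Y_proc q n X t \<omega> = a \<longleftrightarrow> X (2 * nat \<lfloor>q powr (real n / 2) * (q - 1) * t\<rfloor>) \<omega> = chain_state n a"
proof -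
  have "Y_proc q n X t \<omega> = a \<longleftrightarrow>
      real (X (2 * nat \<lfloor>q powr (real n / 2) * (q - 1) * t\<rfloor>) \<omega>) = real (chain_state n a)"
    unfolding Y_proc_def real_chain_state[OF assms] by auto
  then show ?thesis by simp
qed

theorem corollary12:
  fixes q :: nat
    and M :: "nat \<Rightarrow> 'a measure" and X :: "nat \<Rightarrow> nat \<Rightarrow> 'a \<Rightarrow> nat"
    and N :: "'b measure" and Z :: "real \<Rightarrow> 'b \<Rightarrow> real"
    and k :: nat and t :: "nat \<Rightarrow> real" and z0 :: real
  assumes "primepow q"
    and "\<And>n. odd n \<Longrightarrow> discrete_markov_chain (M n) {0..n} (P_mat (real q) n) (X n)"
    and "continuous_markov_chain N half_odd_integers (Q_odd (real q)) Z"
    and "k \<ge> 1" and "0 < t 1" and "strict_mono_on {1..k} t"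
    and "z0 \<in> half_odd_integers"
    and "AE \<omega> in N. Z 0 \<omega> = z0"
    and "\<forall>\<^sub>F n in inf sequentially (principal {n. odd n}).
           AE \<omega> in M n. Y_proc (real q) n (X n) 0 \<omega> = z0"
  shows "((\<lambda>n. tv_dist (fdd (M n) (Y_proc (real q) n (X n)) k t) (fdd N Z k t)) \<longlongrightarrow> 0)
           (inf sequentially (principal {n. odd n}))"
proof -
  note chain = assms(2)
  have q2: "2 \<le> real q" using primepow_gt_Suc_0[OF assms(1)] by simp
  then have q1: "1 < real q" by simp
  interpret lyapunov_rates half_odd_integers "Q_odd (real q)" "\<lambda>x. {x - 1, x, x + 1}" abs 1
    using q1 by (intro lyapunov_rates_Q_odd) simp
  have N: "prob_space N" and countable_S: "countable half_odd_integers"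
    and Z_meas: "\<And>r. 0 \<le> r \<Longrightarrow> Z r \<in> measurable N (count_space half_odd_integers)"
    using assms(3) by (auto simp: continuous_markov_chain_def)
  \<comment> \<open>Time 0 joins the observation times, so that the initial state enters the trajectories as
      \<open>x 0 = z0\<close>.\<close>
  define s where "s i = (if i = 0 then 0 else t i)" for i
  have t_pos: "0 < t i" if "i \<in> {1..k}" for i
    using strict_mono_onD[OF assms(6), of 1 i] that assms(5) by (cases "i = 1") auto
  have s_mono: "strict_mono_on {..k} s"
  proof (rule strict_mono_onI)
    fix i j assume ij: "i \<in> {..k}" "j \<in> {..k}" "i < j"
    show "s i < s j"
    proof (cases "i = 0")
      case True
      then show ?thesis using ij t_pos[of j] by (simp add: s_def)
    next
      case False
      then show ?thesis using ij strict_mono_onD[OF assms(6), of i j] by (simp add: s_def)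
    qed
  qed
  have s_nonneg: "0 \<le> s i" if "i \<le> k" for i
    using t_pos[of i] that by (auto simp: s_def)
  obtain p where p: "transition_function half_odd_integers p"
      "has_rates half_odd_integers p (Q_odd (real q))"
    and law: "\<forall>k s x. 0 \<le> s 0 \<and> strict_mono_on {..k} s \<and> (\<forall>i\<le>k. x i \<in> half_odd_integers) \<longrightarrow>
       measure N {\<omega> \<in> space N. \<forall>i\<le>k. Z (s i) \<omega> = x i}
       = measure N {\<omega> \<in> space N. Z (s 0) \<omega> = x 0} * (\<Prod>i<k. p (s (Suc i) - s i) (x i) (x (Suc i)))"
    using continuous_markov_fdd[OF assms(3)] by (elim exE conjE)
  have Z_borel: "Z (t i) \<in> borel_measurable N" if "i \<in> {1..k}" for i
    using measurable_compose[OF Z_meas[of "t i"], of "\<lambda>x. x" borel] t_pos[OF that] by simp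
  have Z_sets: "{\<omega> \<in> space N. Z r \<omega> = c} \<in> sets N" if "0 \<le> r" for r c
  proof -
    have [measurable]: "Z r \<in> measurable N (count_space half_odd_integers)" using that by (rule Z_meas)
    show ?thesis by measurable
  qed
  have X_meas: "X n i \<in> measurable (M n) (count_space {0..n})" if "odd n" for n i
    using chain[OF that] by (simp add: discrete_markov_chain_def)
  have M: "prob_space (M n)" if "odd n" for n
    using chain[OF that] by (simp add: discrete_markov_chain_def)
  have Y_borel: "Y_proc (real q) n (X n) r \<in> borel_measurable (M n)" if "odd n" for n r
    unfolding Y_proc_def
    using measurable_compose[OF X_meas[OF that], of real borel] by simp
  define T where "T = PiE {1..k} (\<lambda>_. half_odd_integers)"
  have T_UNIV: "y \<in> PiE {1..k} (\<lambda>_. UNIV)" if "y \<in> T" for y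
    using that by (auto simp: T_def PiE_iff)
  define \<tau> where "\<tau> n i = nat \<lfloor>real q powr (real n / 2) * (real q - 1) * s i\<rfloor>" for n i
  define U where "U n j a b = kernel_pow (P_mat (real q) n) {0..n} (2 * j) (chain_state n a) (chain_state n b)"
    for n j a b
  show ?thesis
  proof (rule tv_dist_tendsto_0)
    show "\<forall>\<^sub>F n in along_odd. prob_space (fdd (M n) (Y_proc (real q) n (X n)) k t) \<and>
        sets (fdd (M n) (Y_proc (real q) n (X n)) k t) = sets (fdd N Z k t)"
      using M Y_borel by (auto simp: eventually_inf_principal sets_fdd intro!: always_eventually prob_space_fdd)
    show "prob_space (fdd N Z k t)" using N Z_borel by (rule prob_space_fdd)
    show "countable T" unfolding T_def using countable_S by (intro countable_PiE) auto
    have "half_odd_integers \<in> sets borel" using countable_S by (rule sets.countable[rotated]) auto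
    then have "measure (fdd N Z k t) T = measure N {\<omega> \<in> space N. \<forall>i\<in>{1..k}. Z (t i) \<omega> \<in> half_odd_integers}"
      unfolding T_def using N Z_borel by (intro measure_fdd_PiE)
    also have "{\<omega> \<in> space N. \<forall>i\<in>{1..k}. Z (t i) \<omega> \<in> half_odd_integers} = space N"
      using measurable_space[OF Z_meas] t_pos by (force intro: less_imp_le)
    finally show "measure (fdd N Z k t) T = 1" using N by (simp add: prob_space.prob_space)
    show "{y} \<in> sets (fdd N Z k t)" if "y \<in> T" for y
      unfolding sets_fdd using T_UNIV[OF that] by (rule singleton_in_sets_PiM_borel)
  next
    fix y and e :: real assume y: "y \<in> T" and e: "0 < e"
    define x where "x i = (if i = 0 then z0 else y i)" for i
    have x: "x i \<in> half_odd_integers" if "i \<le> k" for i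
      using that y assms(7) by (auto simp: x_def T_def PiE_iff)
    have all_iff: "(\<forall>i\<le>k. R i) \<longleftrightarrow> R 0 \<and> (\<forall>i\<in>{1..k}. R i)" for R
      by (auto simp: Suc_le_eq)
    have "measure (fdd N Z k t) {y} = measure N {\<omega> \<in> space N. \<forall>i\<in>{1..k}. Z (t i) \<omega> = y i}"
      using N Z_borel T_UNIV[OF y] by (rule measure_fdd_singleton)
    also have "\<dots> = measure N {\<omega> \<in> space N. \<forall>i\<le>k. Z (s i) \<omega> = x i}"
    proof (rule measure_eq_AE)
      show "AE \<omega> in N. \<omega> \<in> {\<omega> \<in> space N. \<forall>i\<in>{1..k}. Z (t i) \<omega> = y i} \<longleftrightarrow>
          \<omega> \<in> {\<omega> \<in> space N. \<forall>i\<le>k. Z (s i) \<omega> = x i}"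
        using assms(8) by eventually_elim (auto simp: all_iff s_def x_def)
      show "{\<omega> \<in> space N. \<forall>i\<in>{1..k}. Z (t i) \<omega> = y i} \<in> sets N"
        using t_pos by (intro sets.sets_Collect_finite_All Z_sets) (auto intro: less_imp_le)
      have "{\<omega> \<in> space N. \<forall>i\<in>{..k}. Z (s i) \<omega> = x i} \<in> sets N"
        using s_nonneg by (intro sets.sets_Collect_finite_All Z_sets) auto
      then show "{\<omega> \<in> space N. \<forall>i\<le>k. Z (s i) \<omega> = x i} \<in> sets N"
        by (simp only: atMost_iff Ball_def)
    qed
    also have "\<dots> = measure N {\<omega> \<in> space N. Z (s 0) \<omega> = x 0} * (\<Prod>i<k. p (s (Suc i) - s i) (x i) (x (Suc i)))"
      using law s_nonneg s_mono x by blast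
    also have "measure N {\<omega> \<in> space N. Z (s 0) \<omega> = x 0} = 1"
      using assms(8) prob_space.prob_Collect_eq_1[OF N Z_sets[of 0]] by (simp add: s_def x_def)
    finally have Z_prob: "measure (fdd N Z k t) {y} = (\<Prod>i<k. p (s (Suc i) - s i) (x i) (x (Suc i)))"
      by simp
    have "\<forall>\<^sub>F n in along_odd. odd n \<and> (\<forall>a\<in>x ` {..k}. \<bar>a\<bar> < real n / 2)"
      using x by (intro eventually_along_odd) auto
    with assms(9) have Y_prob: "\<forall>\<^sub>F n in along_odd. measure (fdd (M n) (Y_proc (real q) n (X n)) k t) {y}
        = (\<Prod>i<k. U n (\<tau> n (Suc i) - \<tau> n i) (x i) (x (Suc i)))"
    proof eventually_elim
      case (elim n)
      then have n: "odd n" and x_bound: "\<And>i. i \<le> k \<Longrightarrow> \<bar>x i\<bar> \<le> real n / 2" by (auto intro: less_imp_le)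
      interpret Mn: prob_space "M n" using n by (rule M)
      have [measurable]: "X n i \<in> measurable (M n) (count_space {0..n})" for i
        using X_meas n by simp
      have Y_iff: "Y_proc (real q) n (X n) (s i) \<omega> = x i \<longleftrightarrow> X n (2 * \<tau> n i) \<omega> = chain_state n (x i)"
        if "i \<le> k" for i \<omega>
        unfolding \<tau>_def using n x[OF that] x_bound[OF that] by (rule Y_proc_eq_iff)
      have "measure (fdd (M n) (Y_proc (real q) n (X n)) k t) {y}
          = measure (M n) {\<omega> \<in> space (M n). \<forall>i\<in>{1..k}. Y_proc (real q) n (X n) (t i) \<omega> = y i}"
        using M[OF n] Y_borel[OF n] T_UNIV[OF y] by (rule measure_fdd_singleton)
      also have "{\<omega> \<in> space (M n). \<forall>i\<in>{1..k}. Y_proc (real q) n (X n) (t i) \<omega> = y i}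
          = {\<omega> \<in> space (M n). \<forall>i\<in>{1..k}. X n (2 * \<tau> n i) \<omega> = chain_state n (x i)}"
        using Y_iff by (force simp: s_def x_def)
      also have "measure (M n) \<dots> = measure (M n) {\<omega> \<in> space (M n). \<forall>i\<le>k. X n (2 * \<tau> n i) \<omega> = chain_state n (x i)}"
      proof (rule measure_eq_AE)
        show "AE \<omega> in M n. \<omega> \<in> {\<omega> \<in> space (M n). \<forall>i\<in>{1..k}. X n (2 * \<tau> n i) \<omega> = chain_state n (x i)} \<longleftrightarrow>
            \<omega> \<in> {\<omega> \<in> space (M n). \<forall>i\<le>k. X n (2 * \<tau> n i) \<omega> = chain_state n (x i)}"
          using elim(1)
        proof eventually_elim
          case (elim \<omega>)
          then have "X n (2 * \<tau> n 0) \<omega> = chain_state n (x 0)" using Y_iff[of 0 \<omega>] by (simp add: s_def x_def)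
          then show ?case by (simp add: all_iff)
        qed
      qed measurable
      also have "\<dots> = measure (M n) {\<omega> \<in> space (M n). X n (2 * \<tau> n 0) \<omega> = chain_state n (x 0)}
          * (\<Prod>i<k. kernel_pow (P_mat (real q) n) {0..n} (2 * \<tau> n (Suc i) - 2 * \<tau> n i)
              (chain_state n (x i)) (chain_state n (x (Suc i))))"
      proof (rule discrete_markov_sampled_law[OF chain[OF n], where \<tau> = "\<lambda>i. 2 * \<tau> n i"])
        fix i assume "i < k"
        then have "s i \<le> s (Suc i)" using strict_mono_onD[OF s_mono, of i "Suc i"] by simp
        then show "2 * \<tau> n i \<le> 2 * \<tau> n (Suc i)"
          unfolding \<tau>_def using q1 by (intro mult_left_mono nat_mono floor_mono) auto
      next
        fix i assume i: "i \<le> k"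
        have "real (chain_state n (x i)) \<le> real n"
          using real_chain_state[OF n x[OF i] x_bound[OF i]] x_bound[OF i] by (auto simp: abs_le_iff)
        then show "chain_state n (x i) \<in> {0..n}" by simp
      qed simp
      also have "measure (M n) {\<omega> \<in> space (M n). X n (2 * \<tau> n 0) \<omega> = chain_state n (x 0)} = 1"
      proof -
        have "AE \<omega> in M n. X n (2 * \<tau> n 0) \<omega> = chain_state n (x 0)"
          using elim(1) by eventually_elim (use Y_iff[of 0] in \<open>simp add: s_def x_def\<close>)
        then show ?thesis by (subst Mn.prob_Collect_eq_1) auto
      qed
      finally show ?case by (simp add: U_def right_diff_distrib')
    qed
    have "\<forall>\<^sub>F n in along_odd. (\<Prod>i<k. p (s (Suc i) - s i) (x i) (x (Suc i))) - e
        \<le> (\<Prod>i<k. U n (\<tau> n (Suc i) - \<tau> n i) (x i) (x (Suc i)))"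
    proof (rule eventually_prod_ge[OF _ _ _ _ e])
      fix i assume i: "i \<in> {..<k}"
      have incr: "s i < s (Suc i)" using i by (intro strict_mono_onD[OF s_mono]) auto
      show "0 \<le> p (s (Suc i) - s i) (x i) (x (Suc i))"
        using p(1) incr x[of i] x[of "Suc i"] i by (auto simp: transition_function_def)
      fix e' :: real assume e': "0 < e'"
      have "\<tau> n i \<le> \<tau> n (Suc i)" for n
        unfolding \<tau>_def using q1 incr by (intro nat_mono floor_mono mult_left_mono) auto
      then have diff: "real (\<tau> n (Suc i) - \<tau> n i) * step_length (real q) n
          = real (\<tau> n (Suc i)) * step_length (real q) n - real (\<tau> n i) * step_length (real q) n" for n
        by (simp add: of_nat_diff left_diff_distrib)
      have "((\<lambda>n. real (\<tau> n (Suc i) - \<tau> n i) * step_length (real q) n) \<longlongrightarrow> s (Suc i) - s i) along_odd"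
        unfolding diff unfolding \<tau>_def using s_nonneg i q1 by (intro tendsto_diff floor_steps_tendsto) auto
      then show "\<forall>\<^sub>F n in along_odd. p (s (Suc i) - s i) (x i) (x (Suc i)) - e'
          \<le> U n (\<tau> n (Suc i) - \<tau> n i) (x i) (x (Suc i))"
      proof (rule eventually_ge_transition_function[OF p step_length_tendsto[OF q1]])
        show "0 < s (Suc i) - s i" using incr by simp
        show "\<forall>\<^sub>F n in along_odd. superconvolutive B (U n)"
          if "finite B" "B \<subseteq> half_odd_integers" for B
          unfolding U_def[abs_def] using q1 that by (rule eventually_superconvolutive_two_step)
        show "\<forall>\<^sub>F n in along_odd. (if a = b then 1 else 0) + step_length (real q) n * (Q_odd (real q) a b - c)
            \<le> U n 1 a b"
          if "a \<in> half_odd_integers" "b \<in> half_odd_integers" "0 < c" for a b c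
          using eventually_two_step_ge[OF q2 that] unfolding U_def mult_1_right .
      qed (use x i e' in auto)
    next
      have "\<forall>\<^sub>F n in along_odd. superconvolutive (x ` {..k}) (U n)"
        unfolding U_def[abs_def] using q1 x by (intro eventually_superconvolutive_two_step) auto
      then show "\<forall>\<^sub>F n in along_odd. \<forall>i\<in>{..<k}. 0 \<le> U n (\<tau> n (Suc i) - \<tau> n i) (x i) (x (Suc i))"
        by eventually_elim (auto simp: superconvolutive_def)
    qed simp
    with Y_prob show "\<forall>\<^sub>F n in along_odd. measure (fdd N Z k t) {y} - e
        \<le> measure (fdd (M n) (Y_proc (real q) n (X n)) k t) {y}"
      by eventually_elim (simp add: Z_prob)
  qed
qed

end
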